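(* Let $A\in\mathbb{R}^{k\times n}$, $b\in\mathbb{R}^k$, and suppose $S:=\{x\in\mathbb{R}^n: b-Ax\ge0\}$ is compact. Let $a,c\in\mathbb{R}^n$ and $g,h\in\mathbb{R}$ satisfy $c^Tx+h>0$ for all $x\in S$. Let $w=(w_1,\ldots,w_n)>0$, $\|x\|:=\sum_{j=1}^nw_j|x_j|$, and $\delta>0$. For $x\in S$ define $$\tilde f(x):=\max_{y}\ \left\{\frac{a^Ty+g}{c^Ty+h}\ :\ \|y-x\|\le\delta,\ y\in S\right\},$$ which equals the optimal value of the linear optimization problem $$(\mathrm{LP}_x)\qquad \begin{array}{llll}\max\limits_{\bar y,\theta,q} & a^T\bar y+g\theta & \\ \text{s.t.} & \bar y-\theta x\le q & (\pi_1)\\ & -\bar y+\theta x\le q & (\pi_2)\\ & w^Tq\le\theta\delta & (\gamma)\\ & c^T\bar y+h\theta=1 & (\tau)\\ & \theta b-A\bar y\ge0 & (\lambda)\\ & \theta\ge0 & (\kappa)\end{array}$$ where the dual variables are indicated in parentheses. There is a set $B\subset S$ of measure zero which makes the following hold: suppose $x\in S\setminus B$, let $(\bar y^*,\theta^*,q^* )$ solve $(\mathrm{LP}_x)$ and let $(\pi_1^*,\pi_2^*,\gamma^*,\tau^*,\lambda^*,\kappa^* )$ be optimal dual variables, and define $$p:=p(x):=\theta^*(\pi_1^*-\pi_2^* ).$$ Then $\nabla\tilde f(x)=p(x)$.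
   Context: Vector inequalities are componentwise and measure zero refers to Lebesgue measure on $\mathbb{R}^n$. The variables of $(\mathrm{LP}_x)$ are $\bar y\in\mathbb{R}^n$, $\theta\in\mathbb{R}$, $q\in\mathbb{R}^n$. The dual linear program of $(\mathrm{LP}_x)$, with the convention that multipliers of inequality constraints are nonnegative, is: minimize $\tau$ subject to $\pi_1-\pi_2+\tau c+A^T\lambda=a$, $\ -x^T\pi_1+x^T\pi_2-\delta\gamma+h\tau-b^T\lambda-\kappa=g$, $\ -\pi_1-\pi_2+\gamma w=0$, $\ \pi_1,\pi_2\in\mathbb{R}^n_+$, $\gamma\ge0$, $\lambda\in\mathbb{R}^k_+$, $\kappa\ge0$, $\tau$ free. *)

theory Defs
  imports "HOL-Analysis.Analysis"
begin

text \<open>Between vectors, \<open>\<le>\<close> is the library's componentwise order. Its strict part \<open><\<close> is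
  not componentwise strictness, so \<open>w > 0\<close> is written as \<open>\<forall>j. 0 < w $ j\<close>.\<close>

definition feasible_region :: "real^'n^'k \<Rightarrow> real^'k \<Rightarrow> (real^'n) set" where
  "feasible_region A b = {x. 0 \<le> b - A *v x}"

definition weighted_norm :: "real^'n \<Rightarrow> real^'n \<Rightarrow> real" where
  "weighted_norm w x = (\<Sum>j\<in>UNIV. w $ j * \<bar>x $ j\<bar>)"

definition is_maximum :: "real set \<Rightarrow> real \<Rightarrow> bool" where
  "is_maximum V v \<longleftrightarrow> v \<in> V \<and> (\<forall>u\<in>V. u \<le> v)"

definition ratio_values ::
  "real^'n^'k \<Rightarrow> real^'k \<Rightarrow> real^'n \<Rightarrow> real \<Rightarrow> real^'n \<Rightarrow> real \<Rightarrow> real^'n \<Rightarrow> real \<Rightarrow> real^'n \<Rightarrow> real set"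
  where
  "ratio_values A b a g c h w \<delta> x =
     {(a \<bullet> y + g) / (c \<bullet> y + h) | y. weighted_norm w (y - x) \<le> \<delta> \<and> y \<in> feasible_region A b}"

text \<open>The supremum stands for a maximum, which is meant only for \<open>x\<close> in the feasible region.
  At other points the value is unspecified when there is no feasible \<open>y\<close>; this does not
  affect the gradient at interior points of the region.\<close>

definition ftilde ::
  "real^'n^'k \<Rightarrow> real^'k \<Rightarrow> real^'n \<Rightarrow> real \<Rightarrow> real^'n \<Rightarrow> real \<Rightarrow> real^'n \<Rightarrow> real \<Rightarrow> real^'n \<Rightarrow> real"
  where
  "ftilde A b a g c h w \<delta> x = Sup (ratio_values A b a g c h w \<delta> x)"

definition lp_feasible ::
  "real^'n^'k \<Rightarrow> real^'k \<Rightarrow> real^'n \<Rightarrow> real \<Rightarrow> real^'n \<Rightarrow> real \<Rightarrow> real^'n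
     \<Rightarrow> real^'n \<Rightarrow> real \<Rightarrow> real^'n \<Rightarrow> bool"
  where
  "lp_feasible A b c h w \<delta> x y \<theta> q \<longleftrightarrow>
     y - \<theta> *\<^sub>R x \<le> q \<and>
     - y + \<theta> *\<^sub>R x \<le> q \<and>
     w \<bullet> q \<le> \<theta> * \<delta> \<and>
     c \<bullet> y + h * \<theta> = 1 \<and>
     0 \<le> \<theta> *\<^sub>R b - A *v y \<and>
     0 \<le> \<theta>"

definition lp_optimal ::
  "real^'n^'k \<Rightarrow> real^'k \<Rightarrow> real^'n \<Rightarrow> real \<Rightarrow> real^'n \<Rightarrow> real \<Rightarrow> real^'n \<Rightarrow> real \<Rightarrow> real^'n
     \<Rightarrow> real^'n \<Rightarrow> real \<Rightarrow> real^'n \<Rightarrow> bool"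
  where
  "lp_optimal A b a g c h w \<delta> x y \<theta> q \<longleftrightarrow>
     lp_feasible A b c h w \<delta> x y \<theta> q \<and>
     (\<forall>y' \<theta>' q'. lp_feasible A b c h w \<delta> x y' \<theta>' q' \<longrightarrow>
        a \<bullet> y' + g * \<theta>' \<le> a \<bullet> y + g * \<theta>)"

definition dual_feasible ::
  "real^'n^'k \<Rightarrow> real^'k \<Rightarrow> real^'n \<Rightarrow> real \<Rightarrow> real^'n \<Rightarrow> real \<Rightarrow> real^'n \<Rightarrow> real \<Rightarrow> real^'n
     \<Rightarrow> real^'n \<Rightarrow> real^'n \<Rightarrow> real \<Rightarrow> real \<Rightarrow> real^'k \<Rightarrow> real \<Rightarrow> bool"
  where
  "dual_feasible A b a g c h w \<delta> x \<pi>\<^sub>1 \<pi>\<^sub>2 \<gamma> \<tau> l \<kappa> \<longleftrightarrow>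
     \<pi>\<^sub>1 - \<pi>\<^sub>2 + \<tau> *\<^sub>R c + transpose A *v l = a \<and>
     - (x \<bullet> \<pi>\<^sub>1) + x \<bullet> \<pi>\<^sub>2 - \<delta> * \<gamma> + h * \<tau> - b \<bullet> l - \<kappa> = g \<and>
     - \<pi>\<^sub>1 - \<pi>\<^sub>2 + \<gamma> *\<^sub>R w = 0 \<and>
     0 \<le> \<pi>\<^sub>1 \<and> 0 \<le> \<pi>\<^sub>2 \<and> 0 \<le> \<gamma> \<and> 0 \<le> l \<and> 0 \<le> \<kappa>"

definition dual_optimal ::
  "real^'n^'k \<Rightarrow> real^'k \<Rightarrow> real^'n \<Rightarrow> real \<Rightarrow> real^'n \<Rightarrow> real \<Rightarrow> real^'n \<Rightarrow> real \<Rightarrow> real^'n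
     \<Rightarrow> real^'n \<Rightarrow> real^'n \<Rightarrow> real \<Rightarrow> real \<Rightarrow> real^'k \<Rightarrow> real \<Rightarrow> bool"
  where
  "dual_optimal A b a g c h w \<delta> x \<pi>\<^sub>1 \<pi>\<^sub>2 \<gamma> \<tau> l \<kappa> \<longleftrightarrow>
     dual_feasible A b a g c h w \<delta> x \<pi>\<^sub>1 \<pi>\<^sub>2 \<gamma> \<tau> l \<kappa> \<and>
     (\<forall>\<pi>\<^sub>1' \<pi>\<^sub>2' \<gamma>' \<tau>' l' \<kappa>'.
        dual_feasible A b a g c h w \<delta> x \<pi>\<^sub>1' \<pi>\<^sub>2' \<gamma>' \<tau>' l' \<kappa>' \<longrightarrow> \<tau> \<le> \<tau>')"

end

theory Submission
  imports Defs
begin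

text \<open>Write \<open>F\<close> for \<open>ftilde\<close> and \<open>S\<close> for the feasible region. Dividing by \<open>\<theta>\<close> turns a solution of the
  linear program at \<open>x\<close> into a maximizer \<open>y\<close> of the ratio with \<open>\<theta> = 1 / (c \<bullet> y + h)\<close>, and strong
  duality (\<open>strong_duality\<close>) says that the dual optimum is \<open>F x\<close>. Eliminating \<open>\<lambda>\<close> and \<open>\<kappa>\<close>, an optimal
  dual solution with \<open>p = \<pi>\<^sub>1 - \<pi>\<^sub>2\<close> becomes a \<open>certificate\<close>: an affine function of \<open>y\<close> that
  dominates \<open>a \<bullet> y + g - F x * (c \<bullet> y + h)\<close> on \<open>S\<close>.

  The certificate at \<open>x\<close> also bounds the ratio at every other point \<open>z\<close>: if \<open>y\<^sub>z\<close> is a maximizer at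
  \<open>z\<close>, then \<open>F z \<le> F x + p \<bullet> (z - x) / (c \<bullet> y\<^sub>z + h)\<close> (\<open>ftilde_le_certificate\<close>). For a gradient
  \<open>\<theta> *\<^sub>R p\<close> two more things are needed: a matching lower bound, and convergence of \<open>1 / (c \<bullet> y\<^sub>z + h)\<close>
  to \<open>\<theta>\<close>. Outside a negligible set, either both hold or \<open>p = 0\<close> and \<open>F\<close> is locally constant.

  Lower bound. Record which rows of \<open>A\<close> are active at the maximizer \<open>y\<close> and which facets of the
  norm ball contain \<open>y - x\<close>. The points \<open>x\<close> that admit a \<open>y\<close> satisfying such a pattern of equations
  form an affine set, its \<open>stratum\<close>. There are finitely many patterns, so the proper strata together
  are negligible. If the stratum is the whole space, every displacement of \<open>x\<close> can be followed
  by a displacement of \<open>y\<close>, linear in it, that preserves all active equations. The moved point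
  competes at \<open>z\<close>, and the certificate shows that its numerator exceeds \<open>F x\<close> times its
  denominator by exactly \<open>p \<bullet> (z - x)\<close> (\<open>full_stratum_moving_point\<close>).

  Convergence. If all maximizers at \<open>x\<close> have the same denominator, compactness of \<open>S\<close> gives the
  convergence (\<open>denominator_tendsto\<close>). If two of them differ, there is a direction \<open>u\<close> with \<open>c \<bullet> u \<noteq> 0\<close>
  along which their midpoint can be moved and remains a maximizer, so \<open>F x = (a \<bullet> u) / (c \<bullet> u)\<close>; this
  number depends only on the pattern active at the midpoint, and \<open>F x\<close> is one of finitely many
  \<open>critical_values\<close>. For each critical value \<open>t\<close> the points of \<open>S\<close> where \<open>t \<le> F\<close> form a convex
  set, so its frontier is negligible; off this frontier, a point of \<open>S\<close> with \<open>F x = t\<close> is a local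
  minimum of \<open>F\<close>, and the upper bound then forces \<open>p = 0\<close> and \<open>F\<close> to be locally constant.\<close>

section \<open>Finite systems of linear inequalities\<close>

text \<open>The cone generated by finitely many vectors is closed, so a vector outside it is strictly
  separated from it, and the separating hyperplane can be moved to the apex.\<close>

lemma farkas:
  fixes N :: "'i::finite \<Rightarrow> 'a::euclidean_space"
  assumes "\<And>d. (\<forall>i. N i \<bullet> d \<le> 0) \<Longrightarrow> v \<bullet> d \<le> 0"
  obtains f where "\<And>i. 0 \<le> f i" "v = (\<Sum>i\<in>UNIV. f i *\<^sub>R N i)"
proof -
  let ?K = "convex_cone hull (range N)"
  let ?C = "{u. \<exists>f. (\<forall>i. 0 \<le> f i) \<and> u = (\<Sum>i\<in>UNIV. f i *\<^sub>R N i)}"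
  have "v \<in> ?K"
  proof (rule ccontr)
    assume "v \<notin> ?K"
    then obtain d \<beta> where v: "d \<bullet> v < \<beta>" and K: "\<And>x. x \<in> ?K \<Longrightarrow> \<beta> < d \<bullet> x"
      using separating_hyperplane_closed_point[of ?K v]
      by (auto simp: convex_convex_cone_hull closed_convex_cone_hull)
    have "\<beta> < 0"
      using K[OF convex_cone_hull_contains_0] by simp
    have "0 \<le> d \<bullet> N i" for i
    proof (rule ccontr)
      assume neg: "\<not> 0 \<le> d \<bullet> N i"
      have "N i \<in> ?K" by (simp add: hull_inc)
      then have "(\<beta> / (d \<bullet> N i)) *\<^sub>R N i \<in> ?K"
        using neg \<open>\<beta> < 0\<close> by (intro convex_cone_hull_mul) (auto simp: divide_nonpos_neg)
      from K[OF this] show False using neg by simp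
    qed
    then have "v \<bullet> (- d) \<le> 0"
      by (intro assms) (simp add: inner_commute)
    then show False
      using v \<open>\<beta> < 0\<close> by (simp add: inner_commute)
  qed
  moreover have "?K \<subseteq> ?C"
  proof (rule hull_minimal)
    show "range N \<subseteq> ?C"
    proof safe
      fix i
      show "\<exists>f. (\<forall>j. 0 \<le> f j) \<and> N i = (\<Sum>j\<in>UNIV. f j *\<^sub>R N j)"
        by (rule exI[of _ "\<lambda>j. if j = i then 1 else 0"]) (simp add: if_distrib [of "\<lambda>r. r *\<^sub>R _"] cong: if_cong)
    qed
    show "convex_cone ?C"
      unfolding convex_cone_iff
    proof (intro conjI ballI allI impI)
      show "0 \<in> ?C" by (auto intro!: exI[of _ "\<lambda>_. 0"])
      fix x y assume "x \<in> ?C" "y \<in> ?C"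
      then obtain f f' where "\<forall>i. 0 \<le> f i" "x = (\<Sum>i\<in>UNIV. f i *\<^sub>R N i)"
        "\<forall>i. 0 \<le> f' i" "y = (\<Sum>i\<in>UNIV. f' i *\<^sub>R N i)" by blast
      then show "x + y \<in> ?C"
        by (auto intro!: exI[of _ "\<lambda>i. f i + f' i"] simp: scaleR_add_left sum.distrib)
    next
      fix x and r :: real assume "x \<in> ?C" "0 \<le> r"
      then obtain f where "\<forall>i. 0 \<le> f i" "x = (\<Sum>i\<in>UNIV. f i *\<^sub>R N i)" by blast
      with \<open>0 \<le> r\<close> show "r *\<^sub>R x \<in> ?C"
        by (auto intro!: exI[of _ "\<lambda>i. r * f i"] simp: scaleR_sum_right)
    qed
  qed
  ultimately show ?thesis using that by blast
qed

text \<open>Inactive inequalities have slack and survive every small perturbation \<open>v\<close>; a perturbation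
  orthogonal to the active normals leaves the active ones tight.\<close>

lemma feasible_under_active_perturbation:
  fixes N :: "'i::finite \<Rightarrow> 'a::real_inner"
  assumes "\<And>i. N i \<bullet> z \<le> \<beta> i"
  shows "\<forall>\<^sub>F v in nhds 0. (\<forall>i. N i \<bullet> z = \<beta> i \<longrightarrow> N i \<bullet> v = 0) \<longrightarrow> (\<forall>i. N i \<bullet> (z + v) \<le> \<beta> i)"
proof -
  have "\<forall>\<^sub>F v in nhds 0. (N i \<bullet> z = \<beta> i \<longrightarrow> N i \<bullet> v = 0) \<longrightarrow> N i \<bullet> (z + v) \<le> \<beta> i" for i
  proof (cases "N i \<bullet> z = \<beta> i")
    case True
    then show ?thesis by (simp add: inner_add_right)
  next
    case False
    have "((\<lambda>v. N i \<bullet> (z + v)) \<longlongrightarrow> N i \<bullet> (z + 0)) (nhds 0)"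
      by (intro tendsto_intros filterlim_ident)
    moreover have "N i \<bullet> (z + 0) < \<beta> i"
      using assms[of i] False by simp
    ultimately have "\<forall>\<^sub>F v in nhds 0. N i \<bullet> (z + v) < \<beta> i"
      by (rule order_tendstoD)
    then show ?thesis by eventually_elim simp
  qed
  then have "\<forall>\<^sub>F v in nhds 0. \<forall>i. (N i \<bullet> z = \<beta> i \<longrightarrow> N i \<bullet> v = 0) \<longrightarrow> N i \<bullet> (z + v) \<le> \<beta> i"
    by (simp add: eventually_all_finite)
  then show ?thesis by eventually_elim blast
qed

text \<open>Along such a \<open>u\<close> one can move both ways without leaving the polyhedron, so at a maximum the
  functional cannot change.\<close>

lemma maximal_functional_vanishes_along_face:
  fixes N :: "'i::finite \<Rightarrow> 'a::real_inner"
  assumes feasible: "\<And>i. N i \<bullet> z \<le> \<beta> i"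
    and maximal: "\<And>z'. (\<And>i. N i \<bullet> z' \<le> \<beta> i) \<Longrightarrow> p \<bullet> z' \<le> p \<bullet> z"
    and u: "\<And>i. N i \<bullet> z = \<beta> i \<Longrightarrow> N i \<bullet> u = 0"
  shows "p \<bullet> u = 0"
proof -
  have "((\<lambda>t. t *\<^sub>R u) \<longlongrightarrow> 0 *\<^sub>R u) (nhds (0::real))"
    by (intro tendsto_intros filterlim_ident)
  then have "filterlim (\<lambda>t. t *\<^sub>R u) (nhds 0) (nhds (0::real))" by simp
  from eventually_compose_filterlim[OF feasible_under_active_perturbation[OF feasible] this]
  have "\<forall>\<^sub>F t::real in nhds 0. \<forall>i. N i \<bullet> (z + t *\<^sub>R u) \<le> \<beta> i"
    by eventually_elim (auto simp: u)
  then obtain e :: real where e: "0 < e" "\<And>t i. \<bar>t\<bar> < e \<Longrightarrow> N i \<bullet> (z + t *\<^sub>R u) \<le> \<beta> i"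
    by (auto simp: eventually_nhds_metric)
  have "p \<bullet> (z + (e/2) *\<^sub>R u) \<le> p \<bullet> z" "p \<bullet> (z + (- e/2) *\<^sub>R u) \<le> p \<bullet> z"
    using e(2)[of "e/2"] e(2)[of "- e/2"] \<open>0 < e\<close> by (auto intro!: maximal)
  then have "(e/2) * (p \<bullet> u) \<le> 0" "0 \<le> (e/2) * (p \<bullet> u)"
    by (simp_all add: inner_diff_right inner_add_right)
  then show ?thesis using \<open>0 < e\<close> by (auto simp: mult_le_0_iff zero_le_mult_iff)
qed

lemma negligible_affine:
  fixes E :: "'a::euclidean_space set"
  assumes "affine E" "E \<noteq> UNIV"
  shows "negligible E"
proof -
  have "interior E = {}"
    using assms affine_hull_nonempty_interior[of E] by (auto simp: affine_hull_eq[THEN iffD2])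
  then show ?thesis
    using affine_imp_convex[OF \<open>affine E\<close>] negligible_convex_interior by blast
qed

section \<open>A squeeze criterion for gradients\<close>

text \<open>The coefficients \<open>\<alpha>\<close> and \<open>\<beta>\<close> may vary with the point: it is the same increment \<open>p \<bullet> (z - x)\<close>
  on both sides, so the error is at most \<open>\<bar>\<alpha> z - \<theta>\<bar> + \<bar>\<beta> z - \<theta>\<bar>\<close> times its absolute value.\<close>

lemma GDERIV_squeeze:
  fixes f :: "'a::real_inner \<Rightarrow> real"
  assumes "(\<alpha> \<longlongrightarrow> \<theta>) (at x)" "(\<beta> \<longlongrightarrow> \<theta>) (at x)"
    and lower: "\<forall>\<^sub>F z in at x. f x + \<alpha> z * (p \<bullet> (z - x)) \<le> f z"
    and upper: "\<forall>\<^sub>F z in at x. f z \<le> f x + \<beta> z * (p \<bullet> (z - x))"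
  shows "GDERIV f x :> \<theta> *\<^sub>R p"
proof -
  let ?m = "\<lambda>z. (\<bar>\<alpha> z - \<theta>\<bar> + \<bar>\<beta> z - \<theta>\<bar>) * norm p"
  have "((\<lambda>z. (f z - f x - (z - x) \<bullet> (\<theta> *\<^sub>R p)) /\<^sub>R norm (z - x)) \<longlongrightarrow> 0) (at x)"
  proof (rule Lim_null_comparison)
    have "(?m \<longlongrightarrow> (\<bar>\<theta> - \<theta>\<bar> + \<bar>\<theta> - \<theta>\<bar>) * norm p) (at x)"
      by (intro tendsto_intros assms)
    then show "(?m \<longlongrightarrow> 0) (at x)" by simp
    have "\<forall>\<^sub>F z in at x. z \<noteq> x"
      by (auto simp: eventually_at_filter)
    then show "\<forall>\<^sub>F z in at x. norm ((f z - f x - (z - x) \<bullet> (\<theta> *\<^sub>R p)) /\<^sub>R norm (z - x)) \<le> ?m z"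
      using lower upper
    proof eventually_elim
      case (elim z)
      let ?s = "p \<bullet> (z - x)"
      let ?R = "f z - f x - \<theta> * ?s"
      have "(\<alpha> z - \<theta>) * ?s \<le> ?R" "?R \<le> (\<beta> z - \<theta>) * ?s"
        using elim by (simp_all add: algebra_simps)
      then have "\<bar>?R\<bar> \<le> \<bar>(\<alpha> z - \<theta>) * ?s\<bar> + \<bar>(\<beta> z - \<theta>) * ?s\<bar>" by linarith
      also have "\<dots> = (\<bar>\<alpha> z - \<theta>\<bar> + \<bar>\<beta> z - \<theta>\<bar>) * \<bar>?s\<bar>" by (simp only: abs_mult distrib_right)
      also have "\<dots> \<le> (\<bar>\<alpha> z - \<theta>\<bar> + \<bar>\<beta> z - \<theta>\<bar>) * (norm p * norm (z - x))"
        by (intro mult_left_mono Cauchy_Schwarz_ineq2) auto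
      finally have "\<bar>?R\<bar> \<le> ?m z * norm (z - x)" by (simp add: algebra_simps)
      then show ?case
        using elim(1) by (simp add: divide_simps inner_commute mult.commute)
    qed
  qed
  then show ?thesis
    unfolding gderiv_def has_derivative_at_within by (blast intro: bounded_linear_inner_left)
qed

section \<open>The region and the norm ball as polyhedra\<close>

text \<open>The ball of radius \<open>\<delta>\<close> is a polyhedron whose facets are indexed by sign vectors; a sign vector
  is encoded by the set \<open>\<sigma>\<close> of its positive coordinates. The normals do not depend on the centre,
  which keeps the number of active patterns finite as \<open>x\<close> varies.\<close>

definition facet_normal :: "real^'n \<Rightarrow> 'n set \<Rightarrow> real^'n" where
  "facet_normal w \<sigma> = (\<chi> j. if j \<in> \<sigma> then w $ j else - w $ j)"

lemma weighted_norm_le_iff: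
  assumes "\<And>j. 0 \<le> w $ j"
  shows "weighted_norm w z \<le> r \<longleftrightarrow> (\<forall>\<sigma>. facet_normal w \<sigma> \<bullet> z \<le> r)"
proof
  assume *: "weighted_norm w z \<le> r"
  show "\<forall>\<sigma>. facet_normal w \<sigma> \<bullet> z \<le> r"
  proof
    fix \<sigma>
    have "facet_normal w \<sigma> \<bullet> z \<le> weighted_norm w z"
      unfolding facet_normal_def weighted_norm_def inner_vec_def
    proof (rule sum_mono)
      fix j show "(\<chi> j. if j \<in> \<sigma> then w $ j else - w $ j) $ j \<bullet> z $ j \<le> w $ j * \<bar>z $ j\<bar>"
        using mult_left_mono[OF abs_ge_self[of "z $ j"] assms[of j]]
          mult_left_mono[OF abs_ge_minus_self[of "z $ j"] assms[of j]] by simp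
    qed
    with * show "facet_normal w \<sigma> \<bullet> z \<le> r" by simp
  qed
next
  assume "\<forall>\<sigma>. facet_normal w \<sigma> \<bullet> z \<le> r"
  moreover have "facet_normal w {j. 0 \<le> z $ j} \<bullet> z = weighted_norm w z"
    unfolding facet_normal_def weighted_norm_def inner_vec_def by (auto intro!: sum.cong)
  ultimately show "weighted_norm w z \<le> r" by metis
qed

text \<open>One half of the duality between the weighted \<open>L1\<close> norm and the correspondingly weighted maximum
  norm.\<close>

lemma inner_le_weighted_norm:
  assumes "\<And>j. \<bar>p $ j\<bar> \<le> \<gamma> * w $ j"
  shows "p \<bullet> z \<le> \<gamma> * weighted_norm w z"
  unfolding weighted_norm_def inner_vec_def sum_distrib_left
proof (rule sum_mono)
  fix j
  have "p $ j * z $ j \<le> \<bar>p $ j\<bar> * \<bar>z $ j\<bar>"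
    by (metis abs_ge_self abs_mult)
  also have "\<dots> \<le> \<gamma> * w $ j * \<bar>z $ j\<bar>"
    by (intro mult_right_mono assms) auto
  finally show "p $ j \<bullet> z $ j \<le> \<gamma> * (w $ j * \<bar>z $ j\<bar>)" by (simp add: mult.assoc)
qed

lemma weighted_norm_0 [simp]: "weighted_norm w 0 = 0"
  by (simp add: weighted_norm_def)

lemma weighted_norm_scaleR: "weighted_norm w (r *\<^sub>R z) = \<bar>r\<bar> * weighted_norm w z"
  by (simp add: weighted_norm_def abs_mult sum_distrib_left algebra_simps)

lemma weighted_norm_add_le:
  assumes "\<And>j. 0 \<le> w $ j"
  shows "weighted_norm w (y + z) \<le> weighted_norm w y + weighted_norm w z"
  unfolding weighted_norm_def sum.distrib[symmetric]
proof (rule sum_mono)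
  fix j
  show "w $ j * \<bar>(y + z) $ j\<bar> \<le> w $ j * \<bar>y $ j\<bar> + w $ j * \<bar>z $ j\<bar>"
    using mult_left_mono[OF abs_triangle_ineq[of "y $ j" "z $ j"] assms[of j]]
    by (simp add: distrib_left)
qed

lemma continuous_on_weighted_norm [continuous_intros]:
  "continuous_on X f \<Longrightarrow> continuous_on X (\<lambda>x. weighted_norm w (f x))"
  unfolding weighted_norm_def by (intro continuous_intros)

lemma weighted_norm_le_0_iff:
  assumes "\<And>j. 0 < w $ j"
  shows "weighted_norm w z \<le> 0 \<longleftrightarrow> z = 0"
proof
  assume "weighted_norm w z \<le> 0"
  moreover have "0 \<le> w $ j * \<bar>z $ j\<bar>" for j using assms[of j] by simp
  ultimately have "\<forall>j\<in>UNIV. w $ j * \<bar>z $ j\<bar> = 0"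
    unfolding weighted_norm_def
    by (subst sum_nonneg_eq_0_iff[symmetric]) (auto intro!: antisym sum_nonneg)
  then show "z = 0"
    using assms by (metis UNIV_I abs_zero abs_eq_0 less_irrefl mult_eq_0_iff vec_eq_iff zero_index)
qed simp

lemma feasible_region_iff: "y \<in> feasible_region A b \<longleftrightarrow> (\<forall>i. A $ i \<bullet> y \<le> b $ i)"
  by (auto simp: feasible_region_def less_eq_vec_def matrix_vector_mul_component)

lemma convex_feasible_region: "convex (feasible_region A b)"
proof -
  have "feasible_region A b = (\<Inter>i. {y. A $ i \<bullet> y \<le> b $ i})"
    by (auto simp: feasible_region_iff)
  then show ?thesis by (auto intro!: convex_INT convex_halfspace_le)
qed


section \<open>Maximizers and multiplier certificates\<close>

locale fractional_program =
  fixes A :: "real^'n^'k" and b :: "real^'k"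
    and a c w :: "real^'n" and g h \<delta> :: real
  assumes compact_region: "compact (feasible_region A b)"
    and den_pos: "x \<in> feasible_region A b \<Longrightarrow> 0 < c \<bullet> x + h"
    and w_pos: "0 < w $ j"
    and \<delta>_pos: "0 < \<delta>"
begin

abbreviation "S \<equiv> feasible_region A b"
abbreviation "F \<equiv> ftilde A b a g c h w \<delta>"

definition maximizer :: "real^'n \<Rightarrow> real^'n \<Rightarrow> bool" where
  "maximizer x y \<longleftrightarrow> y \<in> S \<and> weighted_norm w (y - x) \<le> \<delta> \<and> a \<bullet> y + g = F x * (c \<bullet> y + h)"

text \<open>A dual solution with objective value \<open>\<tau>\<close> in which only \<open>p = \<pi>\<^sub>1 - \<pi>\<^sub>2\<close> and \<open>\<gamma>\<close> are kept. The
  conditions \<open>\<pi>\<^sub>1, \<pi>\<^sub>2 \<ge> 0\<close> and \<open>\<pi>\<^sub>1 + \<pi>\<^sub>2 = \<gamma> *\<^sub>R w\<close> amount to \<open>\<bar>p $ j\<bar> \<le> \<gamma> * w $ j\<close>, and \<open>\<lambda>\<close>, \<open>\<kappa>\<close> are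
  replaced by the inequality that they prove on \<open>S\<close>.\<close>

definition certificate :: "real^'n \<Rightarrow> real^'n \<Rightarrow> real \<Rightarrow> real \<Rightarrow> bool" where
  "certificate x p \<gamma> \<tau> \<longleftrightarrow> 0 \<le> \<gamma> \<and> (\<forall>j. \<bar>p $ j\<bar> \<le> \<gamma> * w $ j) \<and>
     (\<forall>y\<in>S. a \<bullet> y + g - \<tau> * (c \<bullet> y + h) \<le> p \<bullet> (y - x) - \<gamma> * \<delta>)"

lemma w_nonneg: "0 \<le> w $ j"
  using w_pos[of j] by simp

lemma ratio_bdd_above: "bdd_above (ratio_values A b a g c h w \<delta> x)"
proof -
  have "continuous_on S (\<lambda>y. (a \<bullet> y + g) / (c \<bullet> y + h))"
    using den_pos by (intro continuous_intros) force
  then have "bdd_above ((\<lambda>y. (a \<bullet> y + g) / (c \<bullet> y + h)) ` S)"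
    by (intro bounded_imp_bdd_above compact_imp_bounded compact_continuous_image compact_region)
  then show ?thesis
    by (rule bdd_above_mono) (auto simp: ratio_values_def)
qed

lemma numerator_le:
  assumes "y \<in> S" "weighted_norm w (y - x) \<le> \<delta>"
  shows "a \<bullet> y + g \<le> F x * (c \<bullet> y + h)"
proof -
  have "(a \<bullet> y + g) / (c \<bullet> y + h) \<le> F x"
    unfolding ftilde_def using assms
    by (intro cSup_upper ratio_bdd_above) (auto simp: ratio_values_def)
  then show ?thesis using den_pos[OF \<open>y \<in> S\<close>] by (simp add: pos_divide_le_eq)
qed

lemma ratio_is_maximum:
  assumes "x \<in> S"
  shows "is_maximum (ratio_values A b a g c h w \<delta> x) (F x)"
proof -
  let ?P = "S \<inter> {y. weighted_norm w (y - x) \<le> \<delta>}"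
  let ?r = "\<lambda>y. (a \<bullet> y + g) / (c \<bullet> y + h)"
  have "closed {y. weighted_norm w (y - x) \<le> \<delta>}"
    by (intro closed_Collect_le continuous_intros)
  then have "compact ?P" using compact_region by blast
  moreover have "x \<in> ?P" using assms \<delta>_pos by simp
  moreover have "continuous_on ?P ?r"
    using den_pos by (intro continuous_intros) force
  ultimately obtain y where y: "y \<in> ?P" "\<And>z. z \<in> ?P \<Longrightarrow> ?r z \<le> ?r y"
    using continuous_attains_sup[of ?P ?r] by blast
  have mem: "?r y \<in> ratio_values A b a g c h w \<delta> x"
    using y(1) by (auto simp: ratio_values_def)
  moreover have ub: "u \<le> ?r y" if "u \<in> ratio_values A b a g c h w \<delta> x" for u
    using that y(2) by (auto simp: ratio_values_def)
  ultimately have "F x = ?r y"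
    unfolding ftilde_def by (rule cSup_eq_maximum)
  then show ?thesis using mem ub by (simp add: is_maximum_def)
qed

lemma maximizer_exists:
  assumes "x \<in> S"
  obtains y where "maximizer x y"
proof -
  from ratio_is_maximum[OF assms] obtain y
    where y: "y \<in> S" "weighted_norm w (y - x) \<le> \<delta>" "F x = (a \<bullet> y + g) / (c \<bullet> y + h)"
    by (auto simp: is_maximum_def ratio_values_def)
  then show ?thesis
    using den_pos[OF y(1)] by (intro that[of y]) (simp add: maximizer_def)
qed

text \<open>Weak duality for a norm ball with centre \<open>z\<close> other than the centre \<open>x\<close> of the certificate:
  writing \<open>y - x = (y - z) + (z - x)\<close>, the first part is paid for by \<open>\<gamma> * \<delta>\<close>.\<close>

lemma numerator_le_certificate:
  assumes "certificate x p \<gamma> \<tau>" "y \<in> S" "weighted_norm w (y - z) \<le> \<delta>"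
  shows "a \<bullet> y + g \<le> \<tau> * (c \<bullet> y + h) + p \<bullet> (z - x)"
proof -
  have "p \<bullet> (y - z) \<le> \<gamma> * weighted_norm w (y - z)"
    using assms(1) by (intro inner_le_weighted_norm) (simp add: certificate_def)
  also have "\<dots> \<le> \<gamma> * \<delta>"
    using assms by (intro mult_left_mono) (auto simp: certificate_def)
  finally have "p \<bullet> (y - z) \<le> \<gamma> * \<delta>" .
  moreover have "a \<bullet> y + g - \<tau> * (c \<bullet> y + h) \<le> p \<bullet> (y - x) - \<gamma> * \<delta>"
    using assms by (simp add: certificate_def)
  ultimately show ?thesis by (simp add: inner_diff_right)
qed

text \<open>The upper estimate for \<open>F\<close>; for \<open>z = x\<close> it is weak duality. The denominator is that of the
  maximizer at the moving point \<open>z\<close>, which is why its convergence matters later.\<close>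

lemma ftilde_le_certificate:
  assumes "certificate x p \<gamma> \<tau>" "maximizer z y"
  shows "F z \<le> \<tau> + p \<bullet> (z - x) / (c \<bullet> y + h)"
proof -
  have y: "y \<in> S" "weighted_norm w (y - z) \<le> \<delta>" "a \<bullet> y + g = F z * (c \<bullet> y + h)"
    using assms(2) by (auto simp: maximizer_def)
  have "F z * (c \<bullet> y + h) \<le> \<tau> * (c \<bullet> y + h) + p \<bullet> (z - x)"
    using numerator_le_certificate[OF assms(1) y(1,2)] y(3) by simp
  then have "F z \<le> (\<tau> * (c \<bullet> y + h) + p \<bullet> (z - x)) / (c \<bullet> y + h)"
    using den_pos[OF y(1)] by (simp add: pos_le_divide_eq)
  also have "\<dots> = \<tau> + p \<bullet> (z - x) / (c \<bullet> y + h)"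
    using den_pos[OF y(1)] by (simp add: add_divide_distrib)
  finally show ?thesis .
qed

section \<open>The linear program and its dual\<close>

text \<open>The Charnes-Cooper substitution, read backwards. A solution with \<open>\<theta> = 0\<close> would have norm
  at most \<open>0\<close>, hence \<open>y = 0\<close>, against the normalization \<open>c \<bullet> y + h * \<theta> = 1\<close>.\<close>

lemma lp_feasible_normalize:
  assumes "lp_feasible A b c h w \<delta> x y \<theta> q"
  defines "y' \<equiv> y /\<^sub>R \<theta>"
  shows "y' \<in> S" "weighted_norm w (y' - x) \<le> \<delta>" "0 < \<theta>" "\<theta> = inverse (c \<bullet> y' + h)" "y = \<theta> *\<^sub>R y'"
proof -
  have 1: "y - \<theta> *\<^sub>R x \<le> q" "- y + \<theta> *\<^sub>R x \<le> q" "w \<bullet> q \<le> \<theta> * \<delta>" "c \<bullet> y + h * \<theta> = 1"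
    "0 \<le> \<theta> *\<^sub>R b - A *v y" "0 \<le> \<theta>"
    using assms by (auto simp: lp_feasible_def)
  have q: "\<bar>(y - \<theta> *\<^sub>R x) $ j\<bar> \<le> q $ j" for j
    using 1(1,2) by (simp add: less_eq_vec_def abs_le_iff)
  have "weighted_norm w (y - \<theta> *\<^sub>R x) \<le> w \<bullet> q"
    unfolding weighted_norm_def inner_vec_def
    using q w_nonneg by (auto intro!: sum_mono mult_left_mono)
  then have norm_le: "weighted_norm w (y - \<theta> *\<^sub>R x) \<le> \<theta> * \<delta>" using 1(3) by simp
  have "\<theta> \<noteq> 0"
  proof
    assume "\<theta> = 0"
    with norm_le have "y = 0" using weighted_norm_le_0_iff[of w y, OF w_pos] by simp
    with \<open>\<theta> = 0\<close> 1(4) show False by simp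
  qed
  with 1(6) show "0 < \<theta>" by simp
  then show y: "y = \<theta> *\<^sub>R y'" by (simp add: y'_def)
  have "A $ i \<bullet> y \<le> \<theta> * b $ i" for i
    using 1(5) by (simp add: less_eq_vec_def matrix_vector_mul_component)
  then show "y' \<in> S"
    using \<open>0 < \<theta>\<close> by (simp add: y feasible_region_iff)
  have "y - \<theta> *\<^sub>R x = \<theta> *\<^sub>R (y' - x)" by (simp add: y scaleR_diff_right)
  then show "weighted_norm w (y' - x) \<le> \<delta>"
    using norm_le \<open>0 < \<theta>\<close> by (simp add: weighted_norm_scaleR)
  have "\<theta> * (c \<bullet> y' + h) = 1" using 1(4) by (simp add: y algebra_simps)
  then show "\<theta> = inverse (c \<bullet> y' + h)" by (metis inverse_unique mult.commute)
qed

lemma lp_feasible_from_point: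
  assumes "y \<in> S" "weighted_norm w (y - x) \<le> \<delta>"
  defines "\<theta> \<equiv> inverse (c \<bullet> y + h)"
  shows "\<exists>q. lp_feasible A b c h w \<delta> x (\<theta> *\<^sub>R y) \<theta> q"
proof
  have den: "0 < c \<bullet> y + h" using assms den_pos by blast
  then have \<theta>: "0 < \<theta>" by (simp add: \<theta>_def)
  let ?q = "\<chi> j. \<theta> * \<bar>(y - x) $ j\<bar>"
  have bound: "\<theta> * y $ j - \<theta> * x $ j \<le> \<theta> * \<bar>y $ j - x $ j\<bar>"
    "\<theta> * x $ j - \<theta> * y $ j \<le> \<theta> * \<bar>y $ j - x $ j\<bar>" for j
    using \<theta> by (auto simp flip: right_diff_distrib intro!: mult_left_mono)
  have "w \<bullet> ?q = \<theta> * weighted_norm w (y - x)"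
    by (simp add: inner_vec_def weighted_norm_def sum_distrib_left algebra_simps)
  then have "w \<bullet> ?q \<le> \<theta> * \<delta>" using assms(2) \<theta> by simp
  moreover have "c \<bullet> (\<theta> *\<^sub>R y) + h * \<theta> = 1"
  proof -
    have "\<theta> * (c \<bullet> y + h) = 1" using den by (simp add: \<theta>_def)
    then show ?thesis by (simp add: algebra_simps)
  qed
  moreover have "0 \<le> \<theta> *\<^sub>R b - A *v (\<theta> *\<^sub>R y)"
    using assms(1) \<theta> by (simp add: feasible_region_iff less_eq_vec_def matrix_vector_mul_component)
  ultimately show "lp_feasible A b c h w \<delta> x (\<theta> *\<^sub>R y) \<theta> ?q"
    using bound \<theta> by (auto simp: lp_feasible_def less_eq_vec_def)
qed

lemma lp_objective_normalize:
  assumes "\<theta> = inverse (c \<bullet> y + h)"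
  shows "a \<bullet> (\<theta> *\<^sub>R y) + g * \<theta> = (a \<bullet> y + g) / (c \<bullet> y + h)"
  by (simp add: assms divide_inverse algebra_simps)

lemma lp_values_eq_ratio_values:
  "{a \<bullet> y + g * \<theta> | y \<theta> q. lp_feasible A b c h w \<delta> x y \<theta> q} = ratio_values A b a g c h w \<delta> x"
proof (intro equalityI subsetI)
  fix v assume "v \<in> {a \<bullet> y + g * \<theta> | y \<theta> q. lp_feasible A b c h w \<delta> x y \<theta> q}"
  then obtain y \<theta> q where v: "v = a \<bullet> y + g * \<theta>" and lp: "lp_feasible A b c h w \<delta> x y \<theta> q" by blast
  note norm = lp_feasible_normalize[OF lp]
  have "v = (a \<bullet> (y /\<^sub>R \<theta>) + g) / (c \<bullet> (y /\<^sub>R \<theta>) + h)"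
    using lp_objective_normalize[OF norm(4)] unfolding norm(5)[symmetric] v .
  with norm(1,2) show "v \<in> ratio_values A b a g c h w \<delta> x"
    unfolding ratio_values_def by blast
next
  fix v assume "v \<in> ratio_values A b a g c h w \<delta> x"
  then obtain y where y: "v = (a \<bullet> y + g) / (c \<bullet> y + h)" "weighted_norm w (y - x) \<le> \<delta>" "y \<in> S"
    by (auto simp: ratio_values_def)
  let ?\<theta> = "inverse (c \<bullet> y + h)"
  have "v = a \<bullet> (?\<theta> *\<^sub>R y) + g * ?\<theta>"
    unfolding y(1) by (rule lp_objective_normalize[OF refl, symmetric])
  with lp_feasible_from_point[OF y(3,2)]
  show "v \<in> {a \<bullet> y + g * \<theta> | y \<theta> q. lp_feasible A b c h w \<delta> x y \<theta> q}" by blast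
qed

lemma lp_optimal_imp_maximizer:
  assumes "x \<in> S" "lp_optimal A b a g c h w \<delta> x y \<theta> q"
  obtains y' where "maximizer x y'" "\<theta> = inverse (c \<bullet> y' + h)"
proof -
  have lp: "lp_feasible A b c h w \<delta> x y \<theta> q"
    and opt: "\<And>y' \<theta>' q'. lp_feasible A b c h w \<delta> x y' \<theta>' q' \<Longrightarrow> a \<bullet> y' + g * \<theta>' \<le> a \<bullet> y + g * \<theta>"
    using assms(2) by (auto simp: lp_optimal_def)
  note norm = lp_feasible_normalize[OF lp]
  let ?y = "y /\<^sub>R \<theta>"
  have "F x \<in> {a \<bullet> y + g * \<theta> | y \<theta> q. lp_feasible A b c h w \<delta> x y \<theta> q}"
    using ratio_is_maximum[OF assms(1)] unfolding lp_values_eq_ratio_values by (simp add: is_maximum_def)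
  then have "F x \<le> a \<bullet> y + g * \<theta>" using opt by auto
  also have "\<dots> = (a \<bullet> ?y + g) / (c \<bullet> ?y + h)"
    using lp_objective_normalize[OF norm(4)] unfolding norm(5)[symmetric] .
  finally have "F x * (c \<bullet> ?y + h) \<le> a \<bullet> ?y + g"
    using den_pos[OF norm(1)] by (simp add: pos_le_divide_eq)
  then have "maximizer x ?y"
    using numerator_le[OF norm(1,2)] norm(1,2) by (simp add: maximizer_def)
  then show ?thesis using norm(4) that by blast
qed

lemma dual_feasible_imp_certificate:
  assumes "dual_feasible A b a g c h w \<delta> x \<pi>\<^sub>1 \<pi>\<^sub>2 \<gamma> \<tau> l \<kappa>"
  shows "certificate x (\<pi>\<^sub>1 - \<pi>\<^sub>2) \<gamma> \<tau>"
proof -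
  have 1: "a = \<pi>\<^sub>1 - \<pi>\<^sub>2 + \<tau> *\<^sub>R c + transpose A *v l"
    "g = - (x \<bullet> \<pi>\<^sub>1) + x \<bullet> \<pi>\<^sub>2 - \<delta> * \<gamma> + h * \<tau> - b \<bullet> l - \<kappa>"
    "\<pi>\<^sub>1 + \<pi>\<^sub>2 = \<gamma> *\<^sub>R w" "0 \<le> \<pi>\<^sub>1" "0 \<le> \<pi>\<^sub>2" "0 \<le> \<gamma>" "0 \<le> l" "0 \<le> \<kappa>"
    using assms by (auto simp: dual_feasible_def algebra_simps)
  have "\<bar>(\<pi>\<^sub>1 - \<pi>\<^sub>2) $ j\<bar> \<le> \<gamma> * w $ j" for j
  proof -
    have "\<pi>\<^sub>1 $ j + \<pi>\<^sub>2 $ j = \<gamma> * w $ j" using 1(3) by (metis vector_add_component vector_scaleR_component real_scaleR_def)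
    moreover have "0 \<le> \<pi>\<^sub>1 $ j" "0 \<le> \<pi>\<^sub>2 $ j" using 1(4,5) by (simp_all add: less_eq_vec_def)
    ultimately show ?thesis by simp
  qed
  moreover have "a \<bullet> y + g - \<tau> * (c \<bullet> y + h) \<le> (\<pi>\<^sub>1 - \<pi>\<^sub>2) \<bullet> (y - x) - \<gamma> * \<delta>" if "y \<in> S" for y
  proof -
    have "(transpose A *v l) \<bullet> y = l \<bullet> (A *v y)"
      by (simp add: dot_lmul_matrix)
    moreover have "0 \<le> l \<bullet> (b - A *v y)"
      using \<open>y \<in> S\<close> \<open>0 \<le> l\<close> unfolding inner_vec_def feasible_region_def less_eq_vec_def
      by (auto intro!: sum_nonneg)
    ultimately show ?thesis
      using \<open>0 \<le> \<kappa>\<close> by (subst 1(1), subst 1(2)) (simp add: algebra_simps inner_commute)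
  qed
  ultimately show ?thesis using \<open>0 \<le> \<gamma>\<close> by (simp add: certificate_def)
qed

text \<open>Farkas' lemma is applied to the homogeneous system in \<open>(y, \<theta>)\<close> in which the variable \<open>q\<close> has
  been eliminated in favour of the facet inequalities \<open>facet_normal w \<sigma> \<bullet> (y - \<theta> *\<^sub>R x) \<le> \<theta> * \<delta>\<close>. The
  facet multipliers \<open>\<mu>\<close> are split at the end: \<open>\<pi>\<^sub>1\<close> collects the positive coordinates of the facet
  normals, \<open>\<pi>\<^sub>2\<close> the negative ones, and \<open>\<gamma>\<close> is the total mass.\<close>

lemma strong_duality:
  assumes "x \<in> S"
  shows "\<exists>\<pi>\<^sub>1 \<pi>\<^sub>2 \<gamma> l \<kappa>. dual_feasible A b a g c h w \<delta> x \<pi>\<^sub>1 \<pi>\<^sub>2 \<gamma> (F x) l \<kappa>"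
proof -
  let ?\<nu> = "facet_normal w"
  define N :: "'n set + ('k + unit) \<Rightarrow> (real^'n) \<times> real" where
    "N i = (case i of Inl \<sigma> \<Rightarrow> (?\<nu> \<sigma>, - \<delta> - ?\<nu> \<sigma> \<bullet> x)
        | Inr (Inl k) \<Rightarrow> (A $ k, - b $ k) | Inr (Inr u) \<Rightarrow> (0, - 1))" for i
  have N: "N (Inl \<sigma>) = (?\<nu> \<sigma>, - \<delta> - ?\<nu> \<sigma> \<bullet> x)" "N (Inr (Inl k)) = (A $ k, - b $ k)"
    "N (Inr (Inr u)) = (0, - 1)" for \<sigma> k u
    by (simp_all add: N_def)
  have "(a - F x *\<^sub>R c, g - F x * h) \<bullet> d \<le> 0" if "\<forall>i. N i \<bullet> d \<le> 0" for d
  proof -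
    \<comment> \<open>For \<open>\<theta> > 0\<close> the inequality is the optimality of \<open>F x\<close> at \<open>y /\<^sub>R \<theta>\<close>; for \<open>\<theta> = 0\<close> the norm bound forces \<open>y = 0\<close>.\<close>
    obtain y \<theta> where d: "d = (y, \<theta>)" by (cases d)
    have facets: "?\<nu> \<sigma> \<bullet> (y - \<theta> *\<^sub>R x) \<le> \<theta> * \<delta>" for \<sigma>
      using that[rule_format, of "Inl \<sigma>"] by (simp add: N d algebra_simps)
    have rows: "A $ k \<bullet> y \<le> \<theta> * b $ k" for k
      using that[rule_format, of "Inr (Inl k)"] by (simp add: N d algebra_simps)
    have "0 \<le> \<theta>"
      using that[rule_format, of "Inr (Inr ())"] by (simp add: N d)
    have norm: "weighted_norm w (y - \<theta> *\<^sub>R x) \<le> \<theta> * \<delta>"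
      using facets by (simp add: weighted_norm_le_iff[OF w_nonneg])
    show ?thesis
    proof (cases "\<theta> = 0")
      case True
      then have "y = 0" using norm weighted_norm_le_0_iff[of w y, OF w_pos] by simp
      with True show ?thesis by (simp add: d)
    next
      case False
      with \<open>0 \<le> \<theta>\<close> have \<theta>: "0 < \<theta>" by simp
      define z where "z = y /\<^sub>R \<theta>"
      have y: "y = \<theta> *\<^sub>R z" using \<theta> by (simp add: z_def)
      have "z \<in> S" using rows \<theta> by (simp add: y feasible_region_iff)
      moreover have "y - \<theta> *\<^sub>R x = \<theta> *\<^sub>R (z - x)" by (simp add: y scaleR_diff_right)
      then have "weighted_norm w (z - x) \<le> \<delta>"
        using norm \<theta> by (simp add: weighted_norm_scaleR)
      ultimately have "a \<bullet> z + g \<le> F x * (c \<bullet> z + h)" by (rule numerator_le)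
      then have "\<theta> * (a \<bullet> z + g) \<le> \<theta> * (F x * (c \<bullet> z + h))"
        using \<theta> by (intro mult_left_mono) auto
      then show ?thesis by (simp add: d y algebra_simps)
    qed
  qed
  then obtain f where f: "\<And>i. 0 \<le> f i"
    and sum: "(a - F x *\<^sub>R c, g - F x * h) = (\<Sum>i\<in>UNIV. f i *\<^sub>R N i)"
    using farkas[of N] by blast
  define \<mu> where "\<mu> = (\<lambda>\<sigma>. f (Inl \<sigma>))"
  define l :: "real^'k" where "l = (\<chi> k. f (Inr (Inl k)))"
  define \<kappa> where "\<kappa> = f (Inr (Inr ()))"
  define \<gamma> where "\<gamma> = (\<Sum>\<sigma>\<in>UNIV. \<mu> \<sigma>)"
  define P :: "'n set \<Rightarrow> real^'n" where "P \<sigma> = (\<chi> j. if j \<in> \<sigma> then w $ j else 0)" for \<sigma>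
  define M :: "'n set \<Rightarrow> real^'n" where "M \<sigma> = (\<chi> j. if j \<in> \<sigma> then 0 else w $ j)" for \<sigma>
  define \<pi>\<^sub>1 where "\<pi>\<^sub>1 = (\<Sum>\<sigma>\<in>UNIV. \<mu> \<sigma> *\<^sub>R P \<sigma>)"
  define \<pi>\<^sub>2 where "\<pi>\<^sub>2 = (\<Sum>\<sigma>\<in>UNIV. \<mu> \<sigma> *\<^sub>R M \<sigma>)"
  have \<nu>: "?\<nu> \<sigma> = P \<sigma> - M \<sigma>" and PM: "P \<sigma> + M \<sigma> = w" for \<sigma>
    by (simp_all add: vec_eq_iff P_def M_def facet_normal_def)
  have split: "(\<Sum>i\<in>UNIV. G i) = (\<Sum>\<sigma>\<in>UNIV. G (Inl \<sigma>)) + ((\<Sum>k\<in>UNIV. G (Inr (Inl k))) + G (Inr (Inr ())))"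
    for G :: "'n set + ('k + unit) \<Rightarrow> 'x::comm_monoid_add"
    by (simp add: UNIV_Plus_UNIV[symmetric] sum.Plus UNIV_unit)
  have diff: "\<pi>\<^sub>1 - \<pi>\<^sub>2 = (\<Sum>\<sigma>\<in>UNIV. \<mu> \<sigma> *\<^sub>R ?\<nu> \<sigma>)"
    by (simp add: \<pi>\<^sub>1_def \<pi>\<^sub>2_def \<nu> scaleR_diff_right sum_subtractf)
  have trans: "transpose A *v l = (\<Sum>k\<in>UNIV. f (Inr (Inl k)) *\<^sub>R A $ k)"
    by (simp add: vec_eq_iff vector_matrix_mult_def l_def mult.commute)
  have "a - F x *\<^sub>R c = \<pi>\<^sub>1 - \<pi>\<^sub>2 + transpose A *v l"
    using arg_cong[OF sum, of fst] by (simp add: split N fst_sum diff trans \<mu>_def del: transpose_matrix_vector)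
  moreover have "g - F x * h = - \<delta> * \<gamma> - x \<bullet> (\<pi>\<^sub>1 - \<pi>\<^sub>2) - b \<bullet> l - \<kappa>"
  proof -
    have "g - F x * h = (\<Sum>\<sigma>\<in>UNIV. \<mu> \<sigma> * (- \<delta> - ?\<nu> \<sigma> \<bullet> x)) + ((\<Sum>k\<in>UNIV. l $ k * (- b $ k)) - \<kappa>)"
      using arg_cong[OF sum, of snd] by (simp add: split N snd_sum \<mu>_def l_def \<kappa>_def)
    also have "(\<Sum>\<sigma>\<in>UNIV. \<mu> \<sigma> * (- \<delta> - ?\<nu> \<sigma> \<bullet> x)) = - \<delta> * \<gamma> - x \<bullet> (\<pi>\<^sub>1 - \<pi>\<^sub>2)"
      unfolding diff \<gamma>_def
      by (simp add: right_diff_distrib sum_subtractf sum_distrib_left inner_sum_right inner_commute mult.commute sum_negf)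
    also have "(\<Sum>k\<in>UNIV. l $ k * (- b $ k)) = - (b \<bullet> l)"
      by (simp add: inner_vec_def sum_negf mult.commute)
    finally show ?thesis by simp
  qed
  moreover have "\<pi>\<^sub>1 + \<pi>\<^sub>2 = \<gamma> *\<^sub>R w"
    by (simp add: \<pi>\<^sub>1_def \<pi>\<^sub>2_def \<gamma>_def sum.distrib[symmetric] scaleR_add_right[symmetric] PM scaleR_sum_left)
  moreover have "0 \<le> \<pi>\<^sub>1" "0 \<le> \<pi>\<^sub>2"
    using f w_nonneg
    by (auto simp: \<pi>\<^sub>1_def \<pi>\<^sub>2_def less_eq_vec_def P_def M_def \<mu>_def intro!: sum_nonneg)
  moreover have "0 \<le> \<gamma>" "0 \<le> l" "0 \<le> \<kappa>"
    using f by (auto simp: \<gamma>_def l_def \<kappa>_def \<mu>_def less_eq_vec_def intro!: sum_nonneg)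
  ultimately have "dual_feasible A b a g c h w \<delta> x \<pi>\<^sub>1 \<pi>\<^sub>2 \<gamma> (F x) l \<kappa>"
    by (simp add: dual_feasible_def algebra_simps)
  then show ?thesis by blast
qed

lemma dual_optimal_imp_certificate:
  assumes "x \<in> S" "dual_optimal A b a g c h w \<delta> x \<pi>\<^sub>1 \<pi>\<^sub>2 \<gamma> \<tau> l \<kappa>"
  shows "certificate x (\<pi>\<^sub>1 - \<pi>\<^sub>2) \<gamma> (F x)"
proof -
  have cert: "certificate x (\<pi>\<^sub>1 - \<pi>\<^sub>2) \<gamma> \<tau>"
    using assms(2) dual_feasible_imp_certificate by (auto simp: dual_optimal_def)
  obtain y where "maximizer x y" using maximizer_exists[OF assms(1)] .
  then have "F x \<le> \<tau>" using ftilde_le_certificate[OF cert] by fastforce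
  moreover have "\<tau> \<le> F x"
    using strong_duality[OF assms(1)] assms(2) unfolding dual_optimal_def by blast
  ultimately show ?thesis using cert by simp
qed


section \<open>Lower bounds on generic strata\<close>

definition active_rows :: "real^'n \<Rightarrow> 'k set" where
  "active_rows y = {i. A $ i \<bullet> y = b $ i}"

definition active_facets :: "real^'n \<Rightarrow> real^'n \<Rightarrow> 'n set set" where
  "active_facets x y = {\<sigma>. facet_normal w \<sigma> \<bullet> (y - x) = \<delta>}"

text \<open>Only the active equations are imposed, not the remaining inequalities: this makes the set
  affine, and it still contains every \<open>x\<close> whose maximizer has the given pattern.\<close>

definition stratum :: "'k set \<Rightarrow> 'n set set \<Rightarrow> (real^'n) set" where
  "stratum I J = {x. \<exists>y. (\<forall>i\<in>I. A $ i \<bullet> y = b $ i) \<and> (\<forall>\<sigma>\<in>J. facet_normal w \<sigma> \<bullet> (y - x) = \<delta>)}"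

lemma affine_stratum: "affine (stratum I J)"
  unfolding affine_def
proof (intro ballI allI impI)
  fix x1 x2 and s t :: real
  assume "x1 \<in> stratum I J" "x2 \<in> stratum I J" and st: "s + t = 1"
  then obtain y1 y2 where y:
    "\<And>i. i \<in> I \<Longrightarrow> A $ i \<bullet> y1 = b $ i" "\<And>\<sigma>. \<sigma> \<in> J \<Longrightarrow> facet_normal w \<sigma> \<bullet> (y1 - x1) = \<delta>"
    "\<And>i. i \<in> I \<Longrightarrow> A $ i \<bullet> y2 = b $ i" "\<And>\<sigma>. \<sigma> \<in> J \<Longrightarrow> facet_normal w \<sigma> \<bullet> (y2 - x2) = \<delta>"
    unfolding stratum_def by blast
  let ?y = "s *\<^sub>R y1 + t *\<^sub>R y2"
  have "A $ i \<bullet> ?y = b $ i" if "i \<in> I" for i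
    using st by (simp add: inner_add_right y that distrib_right[symmetric])
  moreover have "facet_normal w \<sigma> \<bullet> (?y - (s *\<^sub>R x1 + t *\<^sub>R x2)) = \<delta>" if "\<sigma> \<in> J" for \<sigma>
  proof -
    have "?y - (s *\<^sub>R x1 + t *\<^sub>R x2) = s *\<^sub>R (y1 - x1) + t *\<^sub>R (y2 - x2)"
      by (simp add: algebra_simps)
    then show ?thesis
      using st by (simp add: inner_add_right y that distrib_right[symmetric] del: inner_diff_right)
  qed
  ultimately show "s *\<^sub>R x1 + t *\<^sub>R x2 \<in> stratum I J"
    unfolding stratum_def by blast
qed

text \<open>Complementary slackness: at \<open>y\<close> the certificate inequality is an equality, so \<open>y\<close> maximizes
  \<open>a - F x *\<^sub>R c - p\<close> over \<open>S\<close>.\<close>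

lemma certificate_along_active_rows:
  assumes "certificate x p \<gamma> (F x)" "maximizer x y" "\<And>i. i \<in> active_rows y \<Longrightarrow> A $ i \<bullet> u = 0"
  shows "(a - F x *\<^sub>R c - p) \<bullet> u = 0"
proof (rule maximal_functional_vanishes_along_face[where N = "\<lambda>i. A $ i" and \<beta> = "\<lambda>i. b $ i" and z = y])
  show "A $ i \<bullet> y \<le> b $ i" for i
    using assms(2) by (simp add: maximizer_def feasible_region_iff)
  show "A $ i \<bullet> u = 0" if "A $ i \<bullet> y = b $ i" for i
    using assms(3) that by (simp add: active_rows_def)
  have y: "weighted_norm w (y - x) \<le> \<delta>" "a \<bullet> y + g = F x * (c \<bullet> y + h)"
    using assms(2) by (auto simp: maximizer_def)
  have cert: "0 \<le> \<gamma>" "\<And>j. \<bar>p $ j\<bar> \<le> \<gamma> * w $ j"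
    "\<And>z. z \<in> S \<Longrightarrow> a \<bullet> z + g - F x * (c \<bullet> z + h) \<le> p \<bullet> (z - x) - \<gamma> * \<delta>"
    using assms(1) by (auto simp: certificate_def)
  fix z assume "\<And>i. A $ i \<bullet> z \<le> b $ i"
  then have "z \<in> S" by (simp add: feasible_region_iff)
  have "p \<bullet> (y - x) \<le> \<gamma> * weighted_norm w (y - x)"
    by (rule inner_le_weighted_norm[OF cert(2)])
  also have "\<dots> \<le> \<gamma> * \<delta>" using y(1) cert(1) by (rule mult_left_mono)
  finally show "(a - F x *\<^sub>R c - p) \<bullet> z \<le> (a - F x *\<^sub>R c - p) \<bullet> y"
    using cert(3)[OF \<open>z \<in> S\<close>] y(2) by (simp add: algebra_simps)
qed

text \<open>Complementary slackness for the norm constraint: \<open>y - x\<close> maximizes \<open>p\<close> over the ball.\<close>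

lemma certificate_along_active_facets:
  assumes "certificate x p \<gamma> (F x)" "maximizer x y"
    "\<And>\<sigma>. \<sigma> \<in> active_facets x y \<Longrightarrow> facet_normal w \<sigma> \<bullet> u = 0"
  shows "p \<bullet> u = 0"
proof (rule maximal_functional_vanishes_along_face[where N = "facet_normal w" and \<beta> = "\<lambda>_. \<delta>" and z = "y - x"])
  have y: "y \<in> S" "weighted_norm w (y - x) \<le> \<delta>" "a \<bullet> y + g = F x * (c \<bullet> y + h)"
    using assms(2) by (auto simp: maximizer_def)
  have cert: "0 \<le> \<gamma>" "\<And>j. \<bar>p $ j\<bar> \<le> \<gamma> * w $ j"
    "a \<bullet> y + g - F x * (c \<bullet> y + h) \<le> p \<bullet> (y - x) - \<gamma> * \<delta>"
    using assms(1) y(1) by (auto simp: certificate_def)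
  show "facet_normal w \<sigma> \<bullet> (y - x) \<le> \<delta>" for \<sigma>
    using y(2) by (simp add: weighted_norm_le_iff[OF w_nonneg])
  show "facet_normal w \<sigma> \<bullet> u = 0" if "facet_normal w \<sigma> \<bullet> (y - x) = \<delta>" for \<sigma>
    using assms(3) that by (simp add: active_facets_def)
  fix z assume "\<And>\<sigma>. facet_normal w \<sigma> \<bullet> z \<le> \<delta>"
  then have z: "weighted_norm w z \<le> \<delta>" by (simp add: weighted_norm_le_iff[OF w_nonneg])
  have "p \<bullet> z \<le> \<gamma> * weighted_norm w z"
    by (rule inner_le_weighted_norm[OF cert(2)])
  also have "\<dots> \<le> \<gamma> * \<delta>" using z cert(1) by (rule mult_left_mono)
  finally show "p \<bullet> z \<le> p \<bullet> (y - x)" using cert(3) y(3) by simp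
qed

text \<open>When the stratum is the whole space, each displacement \<open>e\<close> of \<open>x\<close> splits as \<open>v - (v - e)\<close> with
  \<open>v\<close> along the active rows and \<open>v - e\<close> along the active facets. Extending the choice of \<open>v\<close> linearly
  from the coordinate directions gives a map \<open>U\<close>, and \<open>y + U (z - x)\<close> stays admissible for \<open>z\<close> near
  \<open>x\<close>. Slackness along the two kinds of direction yields the numerator exactly.\<close>

lemma full_stratum_moving_point:
  assumes cert: "certificate x p \<gamma> (F x)" and max: "maximizer x y"
    and full: "stratum (active_rows y) (active_facets x y) = UNIV"
  obtains m where "(m \<longlongrightarrow> y) (at x)"
    "\<forall>\<^sub>F z in at x. m z \<in> S \<and> weighted_norm w (m z - z) \<le> \<delta> \<and>
        a \<bullet> m z + g = F x * (c \<bullet> m z + h) + p \<bullet> (z - x)"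
proof -
  have "\<exists>v. (\<forall>i\<in>active_rows y. A $ i \<bullet> v = 0) \<and>
      (\<forall>\<sigma>\<in>active_facets x y. facet_normal w \<sigma> \<bullet> (v - e) = 0)" for e
  proof -
    have "x + e \<in> stratum (active_rows y) (active_facets x y)" by (simp add: full)
    then obtain y' where "\<forall>i\<in>active_rows y. A $ i \<bullet> y' = b $ i"
      "\<forall>\<sigma>\<in>active_facets x y. facet_normal w \<sigma> \<bullet> (y' - (x + e)) = \<delta>"
      unfolding stratum_def by blast
    then show ?thesis
      by (intro exI[of _ "y' - y"]) (auto simp: active_rows_def active_facets_def algebra_simps)
  qed
  then obtain V where V: "\<And>e i. i \<in> active_rows y \<Longrightarrow> A $ i \<bullet> V e = 0"
    "\<And>e \<sigma>. \<sigma> \<in> active_facets x y \<Longrightarrow> facet_normal w \<sigma> \<bullet> (V e - e) = 0"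
    by metis
  define U where "U d = (\<Sum>j\<in>UNIV. d $ j *\<^sub>R V (axis j 1))" for d :: "real^'n"
  have rows: "A $ i \<bullet> U d = 0" if "i \<in> active_rows y" for i d
    by (simp add: U_def inner_sum_right V that)
  have facets: "facet_normal w \<sigma> \<bullet> (U d - d) = 0" if "\<sigma> \<in> active_facets x y" for \<sigma> d
  proof -
    have "d = (\<Sum>j\<in>UNIV. d $ j *\<^sub>R axis j 1)"
      using basis_expansion[of d] by (simp add: scalar_mult_eq_scaleR)
    then have "U d - d = (\<Sum>j\<in>UNIV. d $ j *\<^sub>R V (axis j 1)) - (\<Sum>j\<in>UNIV. d $ j *\<^sub>R axis j 1)"
      by (simp add: U_def)
    also have "\<dots> = (\<Sum>j\<in>UNIV. d $ j *\<^sub>R (V (axis j 1) - axis j 1))"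
      by (simp add: scaleR_diff_right sum_subtractf)
    finally show ?thesis by (simp add: inner_sum_right V that del: inner_diff_right)
  qed
  define m where "m z = y + U (z - x)" for z
  have lim: "((\<lambda>z. U (z - x)) \<longlongrightarrow> 0) (at x)"
  proof -
    have "((\<lambda>z. U (z - x)) \<longlongrightarrow> (\<Sum>j\<in>UNIV. (x - x) $ j *\<^sub>R V (axis j 1))) (at x)"
      unfolding U_def by (intro tendsto_intros)
    then show ?thesis by simp
  qed
  have lim': "((\<lambda>z. U (z - x) - (z - x)) \<longlongrightarrow> 0) (at x)"
    using tendsto_diff[OF lim, of "\<lambda>z. z - x" 0] tendsto_diff[OF tendsto_ident_at[of x UNIV] tendsto_const[of x]] by simp
  have "y \<in> S" "weighted_norm w (y - x) \<le> \<delta>" and eq: "a \<bullet> y + g = F x * (c \<bullet> y + h)"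
    using max by (auto simp: maximizer_def)
  then have feas: "A $ i \<bullet> y \<le> b $ i" "facet_normal w \<sigma> \<bullet> (y - x) \<le> \<delta>" for i \<sigma>
    by (auto simp: feasible_region_iff weighted_norm_le_iff[OF w_nonneg])
  have "\<forall>\<^sub>F z in at x. m z \<in> S"
    using eventually_compose_filterlim[OF feasible_under_active_perturbation[where N = "\<lambda>i. A $ i" and \<beta> = "\<lambda>i. b $ i", OF feas(1)] lim]
    by eventually_elim (use rows in \<open>auto simp: m_def feasible_region_iff active_rows_def\<close>)
  moreover have "\<forall>\<^sub>F z in at x. weighted_norm w (m z - z) \<le> \<delta>"
    using eventually_compose_filterlim[OF feasible_under_active_perturbation[where N = "facet_normal w" and \<beta> = "\<lambda>_. \<delta>", OF feas(2)] lim']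
  proof eventually_elim
    case (elim z)
    have "\<forall>\<sigma>. facet_normal w \<sigma> \<bullet> ((y - x) + (U (z - x) - (z - x))) \<le> \<delta>"
      using elim facets by (auto simp: active_facets_def)
    moreover have "(y - x) + (U (z - x) - (z - x)) = m z - z"
      by (simp add: m_def)
    ultimately show ?case by (simp add: weighted_norm_le_iff[OF w_nonneg])
  qed
  moreover have "a \<bullet> m z + g = F x * (c \<bullet> m z + h) + p \<bullet> (z - x)" for z
  proof -
    have "(a - F x *\<^sub>R c - p) \<bullet> U (z - x) = 0"
      by (rule certificate_along_active_rows[OF cert max rows])
    moreover have "p \<bullet> (U (z - x) - (z - x)) = 0"
      by (rule certificate_along_active_facets[OF cert max facets])
    ultimately show ?thesis using eq by (simp add: m_def algebra_simps)
  qed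
  moreover have "(m \<longlongrightarrow> y) (at x)"
    unfolding m_def using tendsto_add[OF tendsto_const lim, of y] by simp
  ultimately show ?thesis by (intro that[of m]) (auto elim: eventually_elim2)
qed

section \<open>Superlevel sets and critical values\<close>

definition face_directions :: "'k set \<Rightarrow> 'n set set \<Rightarrow> (real^'n) set" where
  "face_directions I J = {u. (\<forall>i\<in>I. A $ i \<bullet> u = 0) \<and> (\<forall>\<sigma>\<in>J. facet_normal w \<sigma> \<bullet> u = 0)}"

text \<open>The values \<open>t\<close> for which the ratio can be constant on a face along which the denominator varies.
  They depend on the constraint normals alone, so one finite set serves every \<open>x\<close>.\<close>

definition critical_values :: "real set" where
  "critical_values = (\<Union>I J. {t. (\<exists>u\<in>face_directions I J. c \<bullet> u \<noteq> 0) \<and>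
     (\<forall>u\<in>face_directions I J. (a - t *\<^sub>R c) \<bullet> u = 0)})"

text \<open>There are finitely many patterns, and for each of them a single \<open>u\<close> with \<open>c \<bullet> u \<noteq> 0\<close> determines
  \<open>t = (a \<bullet> u) / (c \<bullet> u)\<close>.\<close>

lemma finite_critical_values: "finite critical_values"
proof -
  have "finite {t. (\<exists>u\<in>L. c \<bullet> u \<noteq> 0) \<and> (\<forall>u\<in>L. (a - t *\<^sub>R c) \<bullet> u = 0)}" for L
  proof (cases "\<exists>u\<in>L. c \<bullet> u \<noteq> 0")
    case True
    then obtain u where u: "u \<in> L" "c \<bullet> u \<noteq> 0" by blast
    have "t = (a \<bullet> u) / (c \<bullet> u)" if "\<forall>u\<in>L. (a - t *\<^sub>R c) \<bullet> u = 0" for t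
      using that u by (simp add: inner_diff_left field_simps)
    then have "{t. (\<exists>u\<in>L. c \<bullet> u \<noteq> 0) \<and> (\<forall>u\<in>L. (a - t *\<^sub>R c) \<bullet> u = 0)} \<subseteq> {(a \<bullet> u) / (c \<bullet> u)}"
      by blast
    then show ?thesis by (rule finite_subset) simp
  next
    case False
    then show ?thesis by simp
  qed
  then show ?thesis unfolding critical_values_def by simp
qed

text \<open>The midpoint of two maximizers is a maximizer, and a constraint active there is active at both
  ends. Hence \<open>y1 - y2\<close> is a face direction at the midpoint, where slackness annihilates
  \<open>a - F x *\<^sub>R c\<close> on all face directions.\<close>

lemma critical_if_denominators_differ:
  assumes cert: "certificate x p \<gamma> (F x)"
    and max: "maximizer x y1" "maximizer x y2" and neq: "c \<bullet> y1 \<noteq> c \<bullet> y2"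
  shows "F x \<in> critical_values"
proof -
  define y where "y = (1/2) *\<^sub>R y1 + (1/2) *\<^sub>R y2"
  have m: "y1 \<in> S" "y2 \<in> S" "weighted_norm w (y1 - x) \<le> \<delta>" "weighted_norm w (y2 - x) \<le> \<delta>"
    "a \<bullet> y1 + g = F x * (c \<bullet> y1 + h)" "a \<bullet> y2 + g = F x * (c \<bullet> y2 + h)"
    using max by (auto simp: maximizer_def)
  have feas: "A $ i \<bullet> y1 \<le> b $ i" "A $ i \<bullet> y2 \<le> b $ i"
    "facet_normal w \<sigma> \<bullet> (y1 - x) \<le> \<delta>" "facet_normal w \<sigma> \<bullet> (y2 - x) \<le> \<delta>" for i \<sigma>
    using m by (auto simp: feasible_region_iff weighted_norm_le_iff[OF w_nonneg])
  have half: "q \<bullet> y = (q \<bullet> y1 + q \<bullet> y2) / 2" for q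
    by (simp add: y_def inner_add_right)
  have "y \<in> S"
    unfolding y_def by (rule convexD[OF convex_feasible_region m(1,2)]) auto
  moreover have "weighted_norm w (y - x) \<le> \<delta>"
  proof -
    have "facet_normal w \<sigma> \<bullet> (y - x) \<le> \<delta>" for \<sigma>
      using feas(3,4)[of \<sigma>] unfolding inner_diff_right half by argo
    then show ?thesis by (simp add: weighted_norm_le_iff[OF w_nonneg])
  qed
  moreover have "a \<bullet> y + g = F x * (c \<bullet> y + h)"
    using m(5,6) by (simp add: half field_simps)
  ultimately have y: "maximizer x y" by (simp add: maximizer_def)
  let ?L = "face_directions (active_rows y) (active_facets x y)"
  have "A $ i \<bullet> (y1 - y2) = 0" if "i \<in> active_rows y" for i
    using that feas(1,2)[of i] by (simp add: active_rows_def half inner_diff_right)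
  moreover have "facet_normal w \<sigma> \<bullet> (y1 - y2) = 0" if "\<sigma> \<in> active_facets x y" for \<sigma>
    using that feas(3,4)[of \<sigma>] unfolding active_facets_def mem_Collect_eq inner_diff_right half by argo
  ultimately have "y1 - y2 \<in> ?L" by (simp add: face_directions_def)
  moreover have "c \<bullet> (y1 - y2) \<noteq> 0" using neq by (simp add: inner_diff_right)
  moreover have "(a - F x *\<^sub>R c) \<bullet> u = 0" if "u \<in> ?L" for u
    using certificate_along_active_rows[OF cert y, of u] certificate_along_active_facets[OF cert y, of u] that
    by (simp add: face_directions_def inner_diff_left)
  ultimately show ?thesis unfolding critical_values_def by blast
qed

text \<open>\<open>F\<close> is quasiconcave because the condition \<open>t \<le> (a \<bullet> y + g) / (c \<bullet> y + h)\<close> is linear in \<open>y\<close>, while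
  feasibility is jointly convex in \<open>x\<close> and \<open>y\<close>.\<close>

lemma convex_superlevel_set: "convex {x \<in> S. t \<le> F x}"
proof (rule convexI)
  fix x1 x2 and r s :: real
  assume x: "x1 \<in> {x \<in> S. t \<le> F x}" "x2 \<in> {x \<in> S. t \<le> F x}" and rs: "0 \<le> r" "0 \<le> s" "r + s = 1"
  obtain y1 y2 where max: "maximizer x1 y1" "maximizer x2 y2"
    using x maximizer_exists by (metis (no_types, lifting) mem_Collect_eq)
  then have m: "y1 \<in> S" "y2 \<in> S" "weighted_norm w (y1 - x1) \<le> \<delta>" "weighted_norm w (y2 - x2) \<le> \<delta>"
    "a \<bullet> y1 + g = F x1 * (c \<bullet> y1 + h)" "a \<bullet> y2 + g = F x2 * (c \<bullet> y2 + h)"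
    by (auto simp: maximizer_def)
  define x where "x = r *\<^sub>R x1 + s *\<^sub>R x2"
  define y where "y = r *\<^sub>R y1 + s *\<^sub>R y2"
  have "x \<in> S" unfolding x_def using x rs by (intro convexD[OF convex_feasible_region]) auto
  have "y \<in> S" unfolding y_def using m rs by (intro convexD[OF convex_feasible_region]) auto
  have "y - x = r *\<^sub>R (y1 - x1) + s *\<^sub>R (y2 - x2)" by (simp add: x_def y_def algebra_simps)
  then have "weighted_norm w (y - x) \<le> r * weighted_norm w (y1 - x1) + s * weighted_norm w (y2 - x2)"
    using weighted_norm_add_le[of w "r *\<^sub>R (y1 - x1)" "s *\<^sub>R (y2 - x2)", OF w_nonneg] rs
    by (simp add: weighted_norm_scaleR)
  also have "\<dots> \<le> \<delta>" using m rs by (intro convex_bound_le) auto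
  finally have F: "a \<bullet> y + g \<le> F x * (c \<bullet> y + h)" by (rule numerator_le[OF \<open>y \<in> S\<close>])
  have "t * (c \<bullet> y1 + h) \<le> a \<bullet> y1 + g" "t * (c \<bullet> y2 + h) \<le> a \<bullet> y2 + g"
    unfolding m(5,6) using x den_pos[OF m(1)] den_pos[OF m(2)] by (auto intro!: mult_right_mono)
  then have "r * (t * (c \<bullet> y1 + h)) + s * (t * (c \<bullet> y2 + h)) \<le> r * (a \<bullet> y1 + g) + s * (a \<bullet> y2 + g)"
    using rs by (intro add_mono mult_left_mono) auto
  moreover have "r * (q \<bullet> y1 + e) + s * (q \<bullet> y2 + e) = q \<bullet> y + e" for q e
  proof -
    have "r * (q \<bullet> y1 + e) + s * (q \<bullet> y2 + e) = q \<bullet> y + (r + s) * e"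
      by (simp add: y_def inner_add_right algebra_simps)
    then show ?thesis using rs by simp
  qed
  moreover have "r * (t * (c \<bullet> y1 + h)) + s * (t * (c \<bullet> y2 + h)) = t * (r * (c \<bullet> y1 + h) + s * (c \<bullet> y2 + h))"
    by (simp add: algebra_simps)
  ultimately have "t * (c \<bullet> y + h) \<le> a \<bullet> y + g" by simp
  with F have "t * (c \<bullet> y + h) \<le> F x * (c \<bullet> y + h)" by simp
  then have "t \<le> F x" using den_pos[OF \<open>y \<in> S\<close>] by simp
  with \<open>x \<in> S\<close> show "r *\<^sub>R x1 + s *\<^sub>R x2 \<in> {x \<in> S. t \<le> F x}" by (simp add: x_def)
qed

section \<open>Differentiability\<close>

lemma denominator_bounded_below:
  obtains e where "0 < e" "\<And>y. y \<in> S \<Longrightarrow> e \<le> c \<bullet> y + h"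
proof (cases "S = {}")
  case True
  then show ?thesis by (intro that[of 1]) auto
next
  case False
  have "continuous_on S (\<lambda>y. c \<bullet> y + h)" by (intro continuous_intros)
  then obtain y where "y \<in> S" "\<And>z. z \<in> S \<Longrightarrow> c \<bullet> y + h \<le> c \<bullet> z + h"
    using continuous_attains_inf[OF compact_region False] by blast
  then show ?thesis using den_pos by (intro that[of "c \<bullet> y + h"]) auto
qed

text \<open>Moving from \<open>x\<close> in the direction \<open>- p\<close> would decrease \<open>F\<close> by the upper estimate, so \<open>p = 0\<close>; then
  the same estimate says \<open>F z \<le> F x\<close>, and \<open>F\<close> is constant near \<open>x\<close>. The factor \<open>\<theta>\<close> is therefore
  arbitrary.\<close>

lemma gradient_at_local_minimum:
  assumes cert: "certificate x p \<gamma> (F x)" and int: "x \<in> interior {z \<in> S. F x \<le> F z}"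
  shows "GDERIV F x :> \<theta> *\<^sub>R p"
proof -
  from int obtain e where "0 < e" and e: "ball x e \<subseteq> {z \<in> S. F x \<le> F z}"
    unfolding mem_interior by blast
  have "p = 0"
  proof (rule ccontr)
    assume "p \<noteq> 0"
    define s where "s = e / (2 * norm p)"
    have "0 < s" using \<open>0 < e\<close> \<open>p \<noteq> 0\<close> by (simp add: s_def)
    have "x - s *\<^sub>R p \<in> ball x e"
      using \<open>0 < e\<close> \<open>p \<noteq> 0\<close> by (simp add: dist_norm s_def)
    then have z: "x - s *\<^sub>R p \<in> S" "F x \<le> F (x - s *\<^sub>R p)" using e by blast+
    obtain y where y: "maximizer (x - s *\<^sub>R p) y" using maximizer_exists[OF z(1)] .
    then have den: "0 < c \<bullet> y + h" using den_pos by (simp add: maximizer_def)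
    have "0 \<le> p \<bullet> (x - s *\<^sub>R p - x) / (c \<bullet> y + h)"
      using ftilde_le_certificate[OF cert y] z(2) by linarith
    then have "s * (p \<bullet> p) \<le> 0" using den by (simp add: zero_le_divide_iff divide_le_0_iff)
    then have "p \<bullet> p \<le> 0" using \<open>0 < s\<close> by (simp add: mult_le_0_iff)
    then show False using inner_gt_zero_iff[of p] \<open>p \<noteq> 0\<close> by linarith
  qed
  have "F z = F x" if "z \<in> ball x e" for z
  proof -
    have z: "z \<in> S" "F x \<le> F z" using that e by auto
    obtain y where y: "maximizer z y" using maximizer_exists[OF z(1)] .
    show ?thesis using ftilde_le_certificate[OF cert y] z(2) \<open>p = 0\<close> by simp
  qed
  then have "\<forall>\<^sub>F z in at x. F z = F x"
    by (intro eventually_mono[OF eventually_at_ball[OF \<open>0 < e\<close>]]) blast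
  then have "\<forall>\<^sub>F z in at x. F x + \<theta> * (p \<bullet> (z - x)) \<le> F z" "\<forall>\<^sub>F z in at x. F z \<le> F x + \<theta> * (p \<bullet> (z - x))"
    by (auto simp: \<open>p = 0\<close> elim!: eventually_mono)
  then show ?thesis by (rule GDERIV_squeeze[OF tendsto_const tendsto_const])
qed

text \<open>By compactness, maximizers at points converging to \<open>x\<close> accumulate at some point of \<open>S\<close>;
  continuity of \<open>F\<close> at \<open>x\<close> makes it a maximizer at \<open>x\<close>, and those all have \<open>c\<close>-value \<open>r\<close>.\<close>

lemma denominator_tendsto:
  assumes S: "\<forall>\<^sub>F z in at x. z \<in> S" and cont: "(F \<longlongrightarrow> F x) (at x)"
    and Y: "\<And>z. z \<in> S \<Longrightarrow> maximizer z (Y z)"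
    and unique: "\<And>y'. maximizer x y' \<Longrightarrow> c \<bullet> y' = r"
  shows "((\<lambda>z. c \<bullet> Y z) \<longlongrightarrow> r) (at x)"
proof (rule ccontr)
  assume "\<not> ?thesis"
  then obtain e where "0 < e" and e: "\<not> (\<forall>\<^sub>F z in at x. dist (c \<bullet> Y z) r < e)"
    unfolding tendsto_iff by blast
  have "\<not> (\<forall>\<^sub>F z in at x. z \<in> S \<longrightarrow> dist (c \<bullet> Y z) r < e)"
    using e eventually_elim2[OF S] by (metis (mono_tags, lifting))
  then have "\<exists>z. z \<noteq> x \<and> dist z x < d \<and> z \<in> S \<and> e \<le> dist (c \<bullet> Y z) r" if "0 < d" for d
    using that unfolding eventually_at by (meson not_less)
  then have "\<forall>n. \<exists>z. z \<noteq> x \<and> dist z x < inverse (real (Suc n)) \<and> z \<in> S \<and> e \<le> dist (c \<bullet> Y z) r"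
    by simp
  then obtain Z where Z: "\<And>n. Z n \<noteq> x" "\<And>n. dist (Z n) x < inverse (real (Suc n))"
    "\<And>n. Z n \<in> S" "\<And>n. e \<le> dist (c \<bullet> Y (Z n)) r"
    by metis
  have Zx: "Z \<longlonglongrightarrow> x"
    unfolding tendsto_dist_iff[of Z]
    by (rule LIMSEQ_norm_0) (use Z(2) in \<open>simp add: inverse_eq_divide\<close>)
  have "filterlim Z (at x) sequentially"
    unfolding filterlim_at using Zx Z(1) by simp
  then have FZ: "(\<lambda>n. F (Z n)) \<longlonglongrightarrow> F x"
    by (rule filterlim_compose[OF cont])
  have YZ: "Y (Z n) \<in> S" "weighted_norm w (Y (Z n) - Z n) \<le> \<delta>"
    "a \<bullet> Y (Z n) + g = F (Z n) * (c \<bullet> Y (Z n) + h)" for n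
    using Y[OF Z(3)] by (auto simp: maximizer_def)
  obtain l k where l: "l \<in> S" and "strict_mono (k :: nat \<Rightarrow> nat)" and lim: "((\<lambda>n. Y (Z n)) \<circ> k) \<longlonglongrightarrow> l"
    using compact_region YZ(1) unfolding compact_def by meson
  define y where "y n = Y (Z (k n))" for n
  have yl: "y \<longlonglongrightarrow> l" using lim by (simp add: y_def[abs_def] o_def)
  have Zk: "(\<lambda>n. Z (k n)) \<longlonglongrightarrow> x" "(\<lambda>n. F (Z (k n))) \<longlonglongrightarrow> F x"
    using LIMSEQ_subseq_LIMSEQ[OF Zx \<open>strict_mono k\<close>] LIMSEQ_subseq_LIMSEQ[OF FZ \<open>strict_mono k\<close>]
    by (simp_all add: o_def)
  have "(\<lambda>n. weighted_norm w (y n - Z (k n))) \<longlonglongrightarrow> weighted_norm w (l - x)"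
    unfolding weighted_norm_def by (intro tendsto_intros yl Zk)
  then have "weighted_norm w (l - x) \<le> \<delta>"
    by (rule LIMSEQ_le_const2) (auto simp: y_def YZ)
  moreover have "a \<bullet> l + g = F x * (c \<bullet> l + h)"
  proof (rule LIMSEQ_unique)
    show "(\<lambda>n. a \<bullet> y n + g) \<longlonglongrightarrow> a \<bullet> l + g" by (intro tendsto_intros yl)
    have "(\<lambda>n. F (Z (k n)) * (c \<bullet> y n + h)) \<longlonglongrightarrow> F x * (c \<bullet> l + h)"
      by (intro tendsto_intros yl Zk)
    then show "(\<lambda>n. a \<bullet> y n + g) \<longlonglongrightarrow> F x * (c \<bullet> l + h)"
      by (simp add: y_def YZ)
  qed
  ultimately have "c \<bullet> l = r" using l unique by (simp add: maximizer_def)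
  moreover have "(\<lambda>n. dist (c \<bullet> y n) r) \<longlonglongrightarrow> dist (c \<bullet> l) r"
    by (intro tendsto_intros yl)
  then have "e \<le> dist (c \<bullet> l) r"
    by (rule LIMSEQ_le_const) (auto simp: y_def Z)
  ultimately show False using \<open>0 < e\<close> by simp
qed

text \<open>Lower and upper estimates for \<open>F z - F x\<close> have the form \<open>\<alpha> z * (p \<bullet> (z - x))\<close> and
  \<open>\<beta> z * (p \<bullet> (z - x))\<close>. Since \<open>\<beta>\<close> is bounded, they first give continuity of \<open>F\<close> at \<open>x\<close>, which is what
  \<open>\<beta>\<close> needs to converge; then the squeeze applies.\<close>

lemma gradient_on_full_stratum:
  assumes cert: "certificate x p \<gamma> (F x)" and max: "maximizer x y" and int: "x \<in> interior S"
    and full: "stratum (active_rows y) (active_facets x y) = UNIV"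
    and unique: "\<And>y'. maximizer x y' \<Longrightarrow> c \<bullet> y' = c \<bullet> y"
  shows "GDERIV F x :> inverse (c \<bullet> y + h) *\<^sub>R p"
proof -
  have S: "\<forall>\<^sub>F z in at x. z \<in> S"
    using eventually_at_in_open'[of "interior S" x] int interior_subset
    by (auto elim!: eventually_mono)
  have den: "0 < c \<bullet> y + h" using max den_pos by (simp add: maximizer_def)
  have "\<forall>z\<in>S. \<exists>y'. maximizer z y'"
    using maximizer_exists by blast
  then obtain Y where Y: "\<And>z. z \<in> S \<Longrightarrow> maximizer z (Y z)"
    by (metis (no_types))
  obtain m where m: "(m \<longlongrightarrow> y) (at x)"
    and ev: "\<forall>\<^sub>F z in at x. m z \<in> S \<and> weighted_norm w (m z - z) \<le> \<delta> \<and>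
        a \<bullet> m z + g = F x * (c \<bullet> m z + h) + p \<bullet> (z - x)"
    using full_stratum_moving_point[OF cert max full] .
  define \<alpha> where "\<alpha> z = inverse (c \<bullet> m z + h)" for z
  define \<beta> where "\<beta> z = inverse (c \<bullet> Y z + h)" for z
  have lower: "\<forall>\<^sub>F z in at x. F x + \<alpha> z * (p \<bullet> (z - x)) \<le> F z"
    using ev
  proof eventually_elim
    case (elim z)
    then have pos: "0 < c \<bullet> m z + h" using den_pos by blast
    have "F x * (c \<bullet> m z + h) + p \<bullet> (z - x) \<le> F z * (c \<bullet> m z + h)"
      using numerator_le[of "m z" z] elim by simp
    then have "(F x * (c \<bullet> m z + h) + p \<bullet> (z - x)) / (c \<bullet> m z + h) \<le> F z"
      using pos by (simp add: pos_divide_le_eq)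
    moreover have "(F x * (c \<bullet> m z + h) + p \<bullet> (z - x)) / (c \<bullet> m z + h) = F x + \<alpha> z * (p \<bullet> (z - x))"
      using pos by (simp add: \<alpha>_def add_divide_distrib) (simp add: divide_inverse mult.commute)
    ultimately show ?case by simp
  qed
  have upper: "\<forall>\<^sub>F z in at x. F z \<le> F x + \<beta> z * (p \<bullet> (z - x))"
    using S
    by eventually_elim (use ftilde_le_certificate[OF cert Y] in \<open>simp add: \<beta>_def divide_inverse mult.commute\<close>)
  have \<alpha>_lim: "(\<alpha> \<longlongrightarrow> inverse (c \<bullet> y + h)) (at x)"
    unfolding \<alpha>_def using den by (intro tendsto_intros m) simp
  have "(\<beta> \<longlongrightarrow> inverse (c \<bullet> y + h)) (at x)"
  proof -
    obtain e where "0 < e" and e: "\<And>y. y \<in> S \<Longrightarrow> e \<le> c \<bullet> y + h"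
      using denominator_bounded_below by blast
    have lin: "((\<lambda>z. p \<bullet> (z - x)) \<longlongrightarrow> 0) (at x)"
      by (rule tendsto_eq_rhs[where x = "p \<bullet> (x - x)"]) (intro tendsto_intros, simp)
    have "(F \<longlongrightarrow> F x) (at x)"
    proof (rule tendsto_sandwich[OF lower])
      show "((\<lambda>z. F x + \<alpha> z * (p \<bullet> (z - x))) \<longlongrightarrow> F x) (at x)"
        using tendsto_add[OF tendsto_const tendsto_mult[OF \<alpha>_lim lin], of "F x"] by simp
      show "((\<lambda>z. F x + inverse e * \<bar>p \<bullet> (z - x)\<bar>) \<longlongrightarrow> F x) (at x)"
        using tendsto_add[OF tendsto_const tendsto_mult[OF tendsto_const tendsto_rabs[OF lin]], of "F x" "inverse e"] by simp
      show "\<forall>\<^sub>F z in at x. F z \<le> F x + inverse e * \<bar>p \<bullet> (z - x)\<bar>"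
        using S upper
      proof eventually_elim
        case (elim z)
        then have "e \<le> c \<bullet> Y z + h" using Y e by (simp add: maximizer_def)
        then have "0 \<le> \<beta> z" "\<beta> z \<le> inverse e"
          using \<open>0 < e\<close> by (auto simp: \<beta>_def intro: le_imp_inverse_le)
        have "\<beta> z * (p \<bullet> (z - x)) \<le> \<beta> z * \<bar>p \<bullet> (z - x)\<bar>"
          using \<open>0 \<le> \<beta> z\<close> by (intro mult_left_mono) auto
        also have "\<dots> \<le> inverse e * \<bar>p \<bullet> (z - x)\<bar>"
          using \<open>\<beta> z \<le> inverse e\<close> by (intro mult_right_mono) auto
        finally show ?case using elim by simp
      qed
    qed
    then have "((\<lambda>z. c \<bullet> Y z) \<longlongrightarrow> c \<bullet> y) (at x)"
      by (rule denominator_tendsto[OF S _ Y unique])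
    then show ?thesis unfolding \<beta>_def using den by (intro tendsto_inverse tendsto_add tendsto_const) simp_all
  qed
  with \<alpha>_lim show ?thesis by (rule GDERIV_squeeze[OF _ _ lower upper])
qed

definition exceptional_set :: "(real^'n) set" where
  "exceptional_set = S \<inter> (frontier S \<union> (\<Union>t\<in>critical_values. frontier {x \<in> S. t \<le> F x}) \<union>
     (\<Union>I J. if stratum I J = UNIV then {} else stratum I J))"

lemma negligible_exceptional_set: "negligible exceptional_set"
proof -
  have "negligible (frontier S)"
    by (rule negligible_convex_frontier[OF convex_feasible_region])
  moreover have "negligible (\<Union>t\<in>critical_values. frontier {x \<in> S. t \<le> F x})"
    using finite_critical_values negligible_convex_frontier[OF convex_superlevel_set]
    by (intro negligible_Union) auto
  moreover have "negligible (\<Union>I J. if stratum I J = UNIV then {} else stratum I J)"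
    using negligible_affine[OF affine_stratum] by (intro negligible_Union) auto
  ultimately show ?thesis
    unfolding exceptional_set_def by (intro negligible_Int negligible_Un disjI2)
qed

lemma gradient_outside_exceptional_set:
  assumes x: "x \<in> S - exceptional_set" and cert: "certificate x p \<gamma> (F x)" and max: "maximizer x y"
  shows "GDERIV F x :> inverse (c \<bullet> y + h) *\<^sub>R p"
proof (cases "\<exists>y'. maximizer x y' \<and> c \<bullet> y' \<noteq> c \<bullet> y")
  case True
  then have "F x \<in> critical_values"
    using critical_if_denominators_differ[OF cert _ max] by blast
  then have "x \<notin> frontier {z \<in> S. F x \<le> F z}"
    using x by (auto simp: exceptional_set_def)
  moreover have "x \<in> closure {z \<in> S. F x \<le> F z}"
    using x subsetD[OF closure_subset, of x] by simp
  ultimately have "x \<in> interior {z \<in> S. F x \<le> F z}"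
    by (simp add: frontier_def)
  then show ?thesis by (rule gradient_at_local_minimum[OF cert])
next
  case False
  have "x \<in> interior S"
    using x subsetD[OF closure_subset[of S], of x] by (simp add: exceptional_set_def frontier_def)
  moreover have "x \<in> stratum (active_rows y) (active_facets x y)"
    by (auto simp: stratum_def active_rows_def active_facets_def)
  then have "stratum (active_rows y) (active_facets x y) = UNIV"
    using x by (intro ccontr[of "_ = UNIV"]) (auto simp: exceptional_set_def dest!: spec[of _ "active_rows y"] spec[of _ "active_facets x y"])
  ultimately show ?thesis
    using False by (intro gradient_on_full_stratum[OF cert max]) blast+
qed

end

theorem proposition5:
  fixes A :: "real^'n^'k" and b :: "real^'k"
    and a c w :: "real^'n" and g h \<delta> :: real
  defines "S \<equiv> feasible_region A b"
  assumes "compact S"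
    and "\<forall>x\<in>S. c \<bullet> x + h > 0"
    and "\<forall>j. 0 < w $ j"
    and "\<delta> > 0"
  shows "(\<forall>x\<in>S.
            is_maximum (ratio_values A b a g c h w \<delta> x) (ftilde A b a g c h w \<delta> x) \<and>
            is_maximum {a \<bullet> y + g * \<theta> | y \<theta> q. lp_feasible A b c h w \<delta> x y \<theta> q}
              (ftilde A b a g c h w \<delta> x)) \<and>
         (\<exists>B. B \<subseteq> S \<and> B \<in> null_sets lebesgue \<and>
            (\<forall>x y \<theta> q \<pi>\<^sub>1 \<pi>\<^sub>2 \<gamma> \<tau> l \<kappa>.
               x \<in> S - B \<longrightarrow>
               lp_optimal A b a g c h w \<delta> x y \<theta> q \<longrightarrow>
               dual_optimal A b a g c h w \<delta> x \<pi>\<^sub>1 \<pi>\<^sub>2 \<gamma> \<tau> l \<kappa> \<longrightarrow>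
               GDERIV (ftilde A b a g c h w \<delta>) x :> (\<theta> *\<^sub>R (\<pi>\<^sub>1 - \<pi>\<^sub>2))))"
proof -
  interpret fractional_program A b a c w g h \<delta>
    using assms by unfold_locales auto
  show ?thesis
    unfolding S_def
  proof (intro conjI ballI exI[of _ exceptional_set] allI impI)
    fix x assume "x \<in> feasible_region A b"
    then show "is_maximum (ratio_values A b a g c h w \<delta> x) (ftilde A b a g c h w \<delta> x)"
      "is_maximum {a \<bullet> y + g * \<theta> | y \<theta> q. lp_feasible A b c h w \<delta> x y \<theta> q} (ftilde A b a g c h w \<delta> x)"
      unfolding lp_values_eq_ratio_values by (simp_all add: ratio_is_maximum)
  next
    show "exceptional_set \<subseteq> feasible_region A b" by (simp add: exceptional_set_def)
    show "exceptional_set \<in> null_sets lebesgue"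
      using negligible_exceptional_set by (simp add: negligible_iff_null_sets)
  next
    fix x y \<theta> q \<pi>\<^sub>1 \<pi>\<^sub>2 \<gamma> \<tau> l \<kappa>
    assume x: "x \<in> feasible_region A b - exceptional_set"
      and primal: "lp_optimal A b a g c h w \<delta> x y \<theta> q"
      and dual: "dual_optimal A b a g c h w \<delta> x \<pi>\<^sub>1 \<pi>\<^sub>2 \<gamma> \<tau> l \<kappa>"
    from x have "x \<in> feasible_region A b" by simp
    obtain y' where "maximizer x y'" "\<theta> = inverse (c \<bullet> y' + h)"
      using lp_optimal_imp_maximizer[OF \<open>x \<in> feasible_region A b\<close> primal] .
    with gradient_outside_exceptional_set[OF x dual_optimal_imp_certificate[OF \<open>x \<in> feasible_region A b\<close> dual]]
    show "GDERIV (ftilde A b a g c h w \<delta>) x :> (\<theta> *\<^sub>R (\<pi>\<^sub>1 - \<pi>\<^sub>2))" by simp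
  qed
qed

end
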